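(* Let $(Z_n)_{n\ge 0}$ be a supercritical branching process in an i.i.d. random environment satisfying the standing assumptions given in the context. Suppose that there exists a constant $\delta\in(0,1)$ such that $\mathbb{E}X^{2+\delta}=\mathbb{E}(\log m_0)^{2+\delta}<\infty$. Then $$\lim_{n\rightarrow\infty}\frac{\log Z_n}{n}=\mu\quad\text{a.s.}$$
   Context: Branching process in random environment: $\xi=(\xi_0,\xi_1,\ldots)$ is a sequence of i.i.d. random variables (the environment). To each $\xi_n$ is associated an offspring distribution $p(\xi_n)=\{p_k(\xi_n):k\in\mathbb{N}\}$ on $\mathbb{N}=\{0,1,2,\dots\}$. The process is defined by $Z_0=1$ and $Z_{n+1}=\sum_{i=1}^{Z_n}X_{n,i}$ for $n\ge 0$, where, given $\xi$, for each $n$ the variables $(X_{n,i})_{i\ge1}$ are i.i.d. with law $p(\xi_n)$, i.e. $\mathbb{P}(X_{n,i}=k\mid\xi_n)=p_k(\xi_n)$, and are independent of $(Z_1,\ldots,Z_n)$. $\mathbb{P}_\xi$ denotes the conditional probability given $\xi$ (quenched law), and $\mathbb{P}(dx,d\xi)=\mathbb{P}_\xi(dx)\,\tau(d\xi)$ the total (annealed) probability, where $\tau$ is the law of $\xi$; $\mathbb{E}_\xi$ and $\mathbb{E}$ are the corresponding expectations. "a.s." refers to $\mathbb{P}$. Notation: $m_n=\sum_{i\ge0} i\,p_i(\xi_n)$, $X=\log m_0$, $\mu=\mathbb{E}X$, $\sigma^2=\mathbb{E}(X-\mu)^2$. The process is called supercritical if $\mu>0$. Standing assumptions: $\mu>0$;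 $p_0(\xi_0)=0$ a.s. (so $X\ge0$ and $Z_n\ge1$ a.s.); $\sigma\in(0,\infty)$; and $\mathbb{E}\left[\frac{Z_1}{m_0}\log Z_1\right]<\infty$. *)

theory Defs
  imports "HOL-Probability.Probability"
begin

text \<open>
  \<open>N\<close> is the law of a single environment \<open>\<xi>\<^sub>0\<close>, so that the i.i.d. sequence
  \<open>\<xi> = (\<xi>\<^sub>0, \<xi>\<^sub>1, \<dots>)\<close> has the product law \<open>\<tau>\<close>.
\<close>

definition env_law :: "'e measure \<Rightarrow> (nat \<Rightarrow> 'e) measure" where
  "env_law N = (\<Pi>\<^sub>M n\<in>UNIV. N)"

text \<open>
  The total law \<open>\<P>(dx, d\<xi>) = \<P>\<^sub>\<xi>(dx) \<tau>(d\<xi>)\<close>, where the quenched laws \<open>\<P>\<^sub>\<xi> = Q \<xi>\<close> are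
  probability measures on \<open>\<Gamma>\<close>.
\<close>

definition annealed ::
  "'e measure \<Rightarrow> 'x measure \<Rightarrow> ((nat \<Rightarrow> 'e) \<Rightarrow> 'x measure) \<Rightarrow> ('x \<times> (nat \<Rightarrow> 'e)) measure" where
  "annealed N \<Gamma> Q =
     env_law N \<bind> (\<lambda>\<xi>. distr (Q \<xi>) (\<Gamma> \<Otimes>\<^sub>M env_law N) (\<lambda>x. (x, \<xi>)))"

primrec gen_size :: "(nat \<Rightarrow> nat \<Rightarrow> 'x \<Rightarrow> nat) \<Rightarrow> nat \<Rightarrow> 'x \<Rightarrow> nat" where
  "gen_size X 0 x = 1"
| "gen_size X (Suc n) x = (\<Sum>i = 1..gen_size X n x. X n i x)"

text \<open>
  Conditions on the offspring numbers are imposed under \<open>\<P>\<^sub>\<xi>\<close> for \<open>\<tau>\<close>-almost every \<open>\<xi>\<close>, a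
  conditional probability being determined only up to null sets. Only independence from the
  past generation sizes is required of the offspring numbers of different generations.
\<close>

definition bpre ::
  "'e measure \<Rightarrow> ('e \<Rightarrow> nat pmf) \<Rightarrow> 'x measure \<Rightarrow> ((nat \<Rightarrow> 'e) \<Rightarrow> 'x measure) \<Rightarrow>
   (nat \<Rightarrow> nat \<Rightarrow> 'x \<Rightarrow> nat) \<Rightarrow> bool" where
  "bpre N p \<Gamma> Q X \<longleftrightarrow>
     prob_space N \<and>
     (\<forall>k. (\<lambda>e. pmf (p e) k) \<in> borel_measurable N) \<and>
     Q \<in> env_law N \<rightarrow>\<^sub>M prob_algebra \<Gamma> \<and>
     (\<forall>n. \<forall>i\<ge>1. X n i \<in> \<Gamma> \<rightarrow>\<^sub>M count_space UNIV) \<and>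
     (AE \<xi> in env_law N. \<forall>n.
        (\<forall>i\<ge>1. \<forall>k. measure (Q \<xi>) {x \<in> space (Q \<xi>). X n i x = k} = pmf (p (\<xi> n)) k) \<and>
        prob_space.indep_vars (Q \<xi>) (\<lambda>_. count_space UNIV) (X n) {1..} \<and>
        prob_space.indep_var (Q \<xi>)
          (\<Pi>\<^sub>M i\<in>{1..}. count_space UNIV) (\<lambda>x. \<lambda>i\<in>{1..}. X n i x)
          (\<Pi>\<^sub>M j\<in>{1..n}. count_space UNIV) (\<lambda>x. \<lambda>j\<in>{1..n}. gen_size X j x))"

text \<open>
  As a real number, the mean is meaningful only where the series converges; elsewhere
  \<open>suminf\<close> is unspecified.
\<close>

definition offspring_mean :: "('e \<Rightarrow> nat pmf) \<Rightarrow> (nat \<Rightarrow> 'e) \<Rightarrow> nat \<Rightarrow> real" where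
  "offspring_mean p \<xi> n = (\<Sum>i. real i * pmf (p (\<xi> n)) i)"

definition log_mean :: "('e \<Rightarrow> nat pmf) \<Rightarrow> (nat \<Rightarrow> 'e) \<Rightarrow> real" where
  "log_mean p \<xi> = ln (offspring_mean p \<xi> 0)"

definition criticality ::
  "'e measure \<Rightarrow> ('e \<Rightarrow> nat pmf) \<Rightarrow> 'x measure \<Rightarrow> ((nat \<Rightarrow> 'e) \<Rightarrow> 'x measure) \<Rightarrow> real" where
  "criticality N p \<Gamma> Q = (\<integral>(x, \<xi>). log_mean p \<xi> \<partial>annealed N \<Gamma> Q)"

definition log_mean_variance ::
  "'e measure \<Rightarrow> ('e \<Rightarrow> nat pmf) \<Rightarrow> 'x measure \<Rightarrow> ((nat \<Rightarrow> 'e) \<Rightarrow> 'x measure) \<Rightarrow> real" where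
  "log_mean_variance N p \<Gamma> Q =
     (\<integral>(x, \<xi>). (log_mean p \<xi> - criticality N p \<Gamma> Q)\<^sup>2 \<partial>annealed N \<Gamma> Q)"

text \<open>
  The a.s. finiteness of \<open>m\<^sub>0\<close> is implicit in the finiteness of the moments of \<open>ln m\<^sub>0\<close>; it
  is stated explicitly because the mean is a real number here. Finiteness of an expectation
  is integrability, since a non-integrable function has Bochner integral \<open>0\<close>.
\<close>

definition standing_assumptions ::
  "'e measure \<Rightarrow> ('e \<Rightarrow> nat pmf) \<Rightarrow> 'x measure \<Rightarrow> ((nat \<Rightarrow> 'e) \<Rightarrow> 'x measure) \<Rightarrow>
   (nat \<Rightarrow> nat \<Rightarrow> 'x \<Rightarrow> nat) \<Rightarrow> bool" where
  "standing_assumptions N p \<Gamma> Q X \<longleftrightarrow>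
     (AE (x, \<xi>) in annealed N \<Gamma> Q. summable (\<lambda>i. real i * pmf (p (\<xi> 0)) i)) \<and>
     integrable (annealed N \<Gamma> Q) (\<lambda>(x, \<xi>). log_mean p \<xi>) \<and>
     criticality N p \<Gamma> Q > 0 \<and>
     (AE (x, \<xi>) in annealed N \<Gamma> Q. pmf (p (\<xi> 0)) 0 = 0) \<and>
     integrable (annealed N \<Gamma> Q)
       (\<lambda>(x, \<xi>). (log_mean p \<xi> - criticality N p \<Gamma> Q)\<^sup>2) \<and>
     log_mean_variance N p \<Gamma> Q > 0 \<and>
     integrable (annealed N \<Gamma> Q)
       (\<lambda>(x, \<xi>). real (gen_size X 1 x) / offspring_mean p \<xi> 0 * ln (real (gen_size X 1 x)))"

lemma emeasure_annealed:
  assumes "bpre N p \<Gamma> Q X" and A: "A \<in> sets (\<Gamma> \<Otimes>\<^sub>M env_law N)"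
  shows "emeasure (annealed N \<Gamma> Q) A =
    (\<integral>\<^sup>+ \<xi>. emeasure (Q \<xi>) {x \<in> space \<Gamma>. (x, \<xi>) \<in> A} \<partial>env_law N)"
proof -
  have N: "prob_space N" and Q: "Q \<in> env_law N \<rightarrow>\<^sub>M prob_algebra \<Gamma>"
    using assms(1) by (auto simp: bpre_def)
  have Q': "Q \<in> env_law N \<rightarrow>\<^sub>M subprob_algebra \<Gamma>"
    using Q by (rule measurable_prob_algebraD)
  interpret T: prob_space "env_law N"
    unfolding env_law_def by (intro prob_space_PiM N)
  have D: "(\<lambda>\<xi>. distr (Q \<xi>) (\<Gamma> \<Otimes>\<^sub>M env_law N) (\<lambda>x. (x, \<xi>)))
      \<in> env_law N \<rightarrow>\<^sub>M subprob_algebra (\<Gamma> \<Otimes>\<^sub>M env_law N)"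
    by (rule measurable_distr2[OF _ Q']) simp
  have "emeasure (annealed N \<Gamma> Q) A = (\<integral>\<^sup>+ \<xi>. emeasure
      (distr (Q \<xi>) (\<Gamma> \<Otimes>\<^sub>M env_law N) (\<lambda>x. (x, \<xi>))) A \<partial>env_law N)"
    unfolding annealed_def by (rule emeasure_bind[OF T.not_empty D A])
  also have "\<dots> = (\<integral>\<^sup>+ \<xi>. emeasure (Q \<xi>) {x \<in> space \<Gamma>. (x, \<xi>) \<in> A} \<partial>env_law N)"
  proof (rule nn_integral_cong)
    fix \<xi> assume \<xi>: "\<xi> \<in> space (env_law N)"
    have s: "sets (Q \<xi>) = sets \<Gamma>" using Q' \<xi> by (rule sets_kernel)
    have m: "(\<lambda>x. (x, \<xi>)) \<in> Q \<xi> \<rightarrow>\<^sub>M \<Gamma> \<Otimes>\<^sub>M env_law N"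
      using \<xi> by (simp add: measurable_cong_sets[OF s refl])
    show "emeasure (distr (Q \<xi>) (\<Gamma> \<Otimes>\<^sub>M env_law N) (\<lambda>x. (x, \<xi>))) A =
      emeasure (Q \<xi>) {x \<in> space \<Gamma>. (x, \<xi>) \<in> A}"
      unfolding emeasure_distr[OF m A]
      by (rule arg_cong[where f="emeasure (Q \<xi>)"]) (auto simp: sets_eq_imp_space_eq[OF s])
  qed
  finally show ?thesis .
qed

end

theory Submission
  imports Defs "HOL-Library.Discrete_Functions"
begin

text \<open>
  Almost every environment \<open>\<xi>\<close> is treated separately, without the martingale \<open>Z\<^sub>n / (m\<^sub>0 \<cdots> m\<^sub>n\<^sub>-\<^sub>1)\<close>
  having to have a positive limit. Since \<open>\<E>\<^sub>\<xi> Z\<^sub>n = m\<^sub>0 \<cdots> m\<^sub>n\<^sub>-\<^sub>1\<close>, Markov's inequality, Borel--Cantelli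
  and the strong law for \<open>ln m\<^sub>k\<close> bound \<open>ln Z\<^sub>n / n\<close> from above. By the inequality between the harmonic and
  arithmetic means, \<open>\<E>\<^sub>\<xi> (1 / Z\<^sub>n\<^sub>+\<^sub>1) \<le> \<E>\<^sub>\<xi> (1 / Z\<^sub>n) \<cdot> (1 + p\<^sub>1(\<xi>\<^sub>n)) / 2\<close>, so that \<open>\<Sum>\<^sub>n \<E>\<^sub>\<xi> (1 / Z\<^sub>n)\<close>
  converges. With offspring numbers truncated at \<open>K\<close>, of mean \<open>m\<^sub>n(K)\<close>, Chebyshev's inequality gives
  \<open>Z\<^sub>n\<^sub>+\<^sub>1 < (1 - \<epsilon>) m\<^sub>n(K) Z\<^sub>n\<close> conditional probability at most \<open>K\<^sup>2 / (\<epsilon>\<^sup>2 Z\<^sub>n)\<close>; hence this happens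
  only finitely often, and \<open>ln Z\<^sub>n / n\<close> is asymptotically at least \<open>\<E> ln m\<^sub>0(K) + ln (1 - \<epsilon>)\<close>.
  Let \<open>K \<rightarrow> \<infinity>\<close> and \<open>\<epsilon> \<rightarrow> 0\<close>.
\<close>

section \<open>The strong law for nonnegative variables\<close>

text \<open>The partial sums increase, so with \<open>m = floor_sqrt n\<close> the average at
  \<open>n\<close> lies between \<open>s (m^2) / (m+1)^2\<close> and
  \<open>s ((m+1)^2) / m^2\<close>. Both bounds tend to \<open>c\<close> because consecutive squares
  have ratio tending to 1.\<close>

lemma averages_tendsto_of_square_averages:
  fixes a :: "nat \<Rightarrow> real"
  assumes nonneg: "\<And>k. 0 \<le> a k"
    and lim: "(\<lambda>n. (\<Sum>k<n\<^sup>2. a k) / real (n\<^sup>2)) \<longlonglongrightarrow> c"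
  shows "(\<lambda>n. (\<Sum>k<n. a k) / real n) \<longlonglongrightarrow> c"
proof -
  define s where "s n = (\<Sum>k<n. a k)" for n
  have s_mono: "s m \<le> s n" if "m \<le> n" for m n
    unfolding s_def using that nonneg by (intro sum_mono2) auto
  have s_nonneg: "0 \<le> s n" for n
    unfolding s_def by (intro sum_nonneg nonneg)
  have lims: "(\<lambda>n. s (n\<^sup>2) / real (n\<^sup>2)) \<longlonglongrightarrow> c"
    using lim by (simp add: s_def)
  have fs: "filterlim floor_sqrt at_top sequentially"
    unfolding filterlim_at_top
  proof
    fix z show "\<forall>\<^sub>F n in sequentially. z \<le> floor_sqrt n"
      using eventually_ge_at_top[of "z\<^sup>2"] by eventually_elim (rule le_floor_sqrtI)
  qed
  have r: "(\<lambda>m. real (m\<^sup>2) / real ((Suc m)\<^sup>2)) \<longlonglongrightarrow> 1"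
  proof -
    have "(\<lambda>m. (real m / real (Suc m))\<^sup>2) \<longlonglongrightarrow> 1\<^sup>2"
      by (intro tendsto_power LIMSEQ_n_over_Suc_n)
    then show ?thesis by (simp add: power_divide)
  qed
  have "(\<lambda>m. s (m\<^sup>2) / real (m\<^sup>2) * (real (m\<^sup>2) / real ((Suc m)\<^sup>2))) \<longlonglongrightarrow> c * 1"
    by (intro tendsto_mult lims r)
  then have "(\<lambda>m. s (m\<^sup>2) / real ((Suc m)\<^sup>2)) \<longlonglongrightarrow> c * 1"
  proof (rule Lim_transform_eventually)
    show "\<forall>\<^sub>F m in sequentially. s (m\<^sup>2) / real (m\<^sup>2) * (real (m\<^sup>2) / real ((Suc m)\<^sup>2))
        = s (m\<^sup>2) / real ((Suc m)\<^sup>2)"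
      using eventually_gt_at_top[of 0] by eventually_elim simp
  qed
  then have lo: "(\<lambda>m. s (m\<^sup>2) / real ((Suc m)\<^sup>2)) \<longlonglongrightarrow> c"
    by simp
  have "(\<lambda>m. s ((Suc m)\<^sup>2) / real ((Suc m)\<^sup>2) / (real (m\<^sup>2) / real ((Suc m)\<^sup>2))) \<longlonglongrightarrow> c / 1"
    by (intro tendsto_divide LIMSEQ_Suc[OF lims] r) simp
  then have hi: "(\<lambda>m. s ((Suc m)\<^sup>2) / real (m\<^sup>2)) \<longlonglongrightarrow> c"
    by (simp add: field_simps)
  have "(\<lambda>n. s n / real n) \<longlonglongrightarrow> c"
  proof (rule tendsto_sandwich)
    show "(\<lambda>n. s ((floor_sqrt n)\<^sup>2) / real ((Suc (floor_sqrt n))\<^sup>2)) \<longlonglongrightarrow> c"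
      by (rule filterlim_compose[OF lo fs])
    show "(\<lambda>n. s ((Suc (floor_sqrt n))\<^sup>2) / real ((floor_sqrt n)\<^sup>2)) \<longlonglongrightarrow> c"
      by (rule filterlim_compose[OF hi fs])
    show "\<forall>\<^sub>F n in sequentially. s ((floor_sqrt n)\<^sup>2) / real ((Suc (floor_sqrt n))\<^sup>2) \<le> s n / real n"
      using eventually_gt_at_top[of 0]
    proof eventually_elim
      case (elim n)
      have "real n \<le> real ((Suc (floor_sqrt n))\<^sup>2)"
        using Suc_floor_sqrt_power2_gt[of n] by (simp only: of_nat_le_iff)
      with elim show ?case by (intro frac_le s_nonneg s_mono) auto
    qed
    show "\<forall>\<^sub>F n in sequentially. s n / real n \<le> s ((Suc (floor_sqrt n))\<^sup>2) / real ((floor_sqrt n)\<^sup>2)"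
      using eventually_gt_at_top[of 0]
    proof eventually_elim
      case (elim n)
      have "n \<le> (Suc (floor_sqrt n))\<^sup>2"
        using Suc_floor_sqrt_power2_gt[of n] by simp
      moreover have "real ((floor_sqrt n)\<^sup>2) \<le> real n"
        using floor_sqrt_power2_le[of n] by (simp only: of_nat_le_iff)
      ultimately show ?case using elim by (intro frac_le s_nonneg s_mono) auto
    qed
  qed
  then show ?thesis by (simp add: s_def)
qed

text \<open>By monotone convergence the series of the \<open>f n\<close> has finite integral, so it
  converges almost everywhere and its terms vanish. The lemma serves for squared averages, for
  first-moment bounds and, applied to indicators, as the Borel-Cantelli lemma.\<close>

lemma AE_tendsto_zero_of_summable_integrals:
  fixes f :: "nat \<Rightarrow> 'a \<Rightarrow> real"
  assumes [measurable]: "\<And>n. f n \<in> borel_measurable M"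
    and nonneg: "\<And>n x. 0 \<le> f n x"
    and le: "\<And>n. (\<integral>\<^sup>+ x. ennreal (f n x) \<partial>M) \<le> ennreal (c n)"
    and c: "\<And>n. 0 \<le> c n" "summable c"
  shows "AE x in M. (\<lambda>n. f n x) \<longlonglongrightarrow> 0"
proof -
  have "(\<integral>\<^sup>+ x. (\<Sum>n. ennreal (f n x)) \<partial>M) = (\<Sum>n. \<integral>\<^sup>+ x. ennreal (f n x) \<partial>M)"
    by (rule nn_integral_suminf) simp
  also have "\<dots> \<le> (\<Sum>n. ennreal (c n))"
    by (intro suminf_le le) auto
  also have "\<dots> = ennreal (suminf c)"
    using c by (intro suminf_ennreal2)
  also have "\<dots> < \<top>" by simp
  finally have "AE x in M. (\<Sum>n. ennreal (f n x)) \<noteq> \<infinity>"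
    by (intro nn_integral_noteq_infinite) auto
  then show ?thesis
  proof eventually_elim
    case (elim x)
    then have "summable (\<lambda>n. f n x)"
      using nonneg by (intro summable_suminf_not_top) (auto simp: infinity_ennreal_def)
    then show ?case by (rule summable_LIMSEQ_zero)
  qed
qed

text \<open>Expanding the square leaves only the diagonal: a mixed product of centred independent
  variables has expectation 0. This is the variance computation behind both uses of Chebyshev's
  inequality, for the environment and for the offspring.\<close>

lemma (in prob_space)
  fixes Y :: "'i \<Rightarrow> 'a \<Rightarrow> real"
  assumes I: "finite I" and indep: "indep_vars (\<lambda>_. borel) Y I"
    and sq: "\<And>i. i \<in> I \<Longrightarrow> integrable M (\<lambda>x. (Y i x)\<^sup>2)"
    and zero: "\<And>i. i \<in> I \<Longrightarrow> expectation (Y i) = 0"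
  shows integrable_square_sum_indep: "integrable M (\<lambda>x. (\<Sum>i\<in>I. Y i x)\<^sup>2)"
    and expectation_square_sum_indep:
      "expectation (\<lambda>x. (\<Sum>i\<in>I. Y i x)\<^sup>2) = (\<Sum>i\<in>I. expectation (\<lambda>x. (Y i x)\<^sup>2))"
proof -
  have rv: "random_variable borel (Y i)" if "i \<in> I" for i
    using indep that by (auto simp: indep_vars_def)
  have int: "integrable M (Y i)" if "i \<in> I" for i
    using rv[OF that] sq[OF that] by (rule square_integrable_imp_integrable)
  have offdiag: "integrable M (\<lambda>x. Y i x * Y j x) \<and> expectation (\<lambda>x. Y i x * Y j x) = 0"
    if "i \<in> I" "j \<in> I" "i \<noteq> j" for i j
  proof -
    have *: "indep_vars (\<lambda>_. borel) Y {i, j}"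
      using that by (intro indep_vars_subset[OF indep]) auto
    have "integrable M (\<lambda>x. \<Prod>k\<in>{i, j}. Y k x)"
      using that int by (intro indep_vars_integrable[OF _ *]) auto
    moreover have "expectation (\<lambda>x. \<Prod>k\<in>{i, j}. Y k x) = (\<Prod>k\<in>{i, j}. expectation (Y k))"
      using that int by (intro indep_vars_lebesgue_integral[OF _ *]) auto
    ultimately show ?thesis using that zero by simp
  qed
  have expand: "(\<Sum>i\<in>I. Y i x)\<^sup>2 = (\<Sum>i\<in>I. \<Sum>j\<in>I. Y i x * Y j x)" for x
    by (simp add: power2_eq_square sum_product)
  have prod_int: "integrable M (\<lambda>x. Y i x * Y j x)" if "i \<in> I" "j \<in> I" for i j
    using offdiag[of i j] sq[of i] that by (cases "i = j") (auto simp: power2_eq_square)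
  show "integrable M (\<lambda>x. (\<Sum>i\<in>I. Y i x)\<^sup>2)"
    unfolding expand using prod_int by (intro Bochner_Integration.integrable_sum)
  have "expectation (\<lambda>x. (\<Sum>i\<in>I. Y i x)\<^sup>2)
      = (\<Sum>i\<in>I. \<Sum>j\<in>I. expectation (\<lambda>x. Y i x * Y j x))"
    unfolding expand using prod_int
    by (subst Bochner_Integration.integral_sum, simp)
       (intro sum.cong refl Bochner_Integration.integral_sum, auto)
  also have "\<dots> = (\<Sum>i\<in>I. expectation (\<lambda>x. Y i x * Y i x))"
  proof (rule sum.cong[OF refl])
    fix i assume i: "i \<in> I"
    have "(\<Sum>j\<in>I. expectation (\<lambda>x. Y i x * Y j x))
        = (\<Sum>j\<in>I. if j = i then expectation (\<lambda>x. Y i x * Y i x) else 0)"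
      using offdiag i by (intro sum.cong) auto
    then show "(\<Sum>j\<in>I. expectation (\<lambda>x. Y i x * Y j x)) = expectation (\<lambda>x. Y i x * Y i x)"
      using I i by simp
  qed
  finally show "expectation (\<lambda>x. (\<Sum>i\<in>I. Y i x)\<^sup>2) = (\<Sum>i\<in>I. expectation (\<lambda>x. (Y i x)\<^sup>2))"
    by (simp add: power2_eq_square)
qed

text \<open>The average of the first \<open>n^2\<close> variables has variance
  \<open>v / n^2\<close>, which is summable, so the averages converge along the squares.
  Nonnegativity then fills the gaps between consecutive squares.\<close>

lemma (in prob_space) strong_law_nonneg_L2:
  fixes Y :: "nat \<Rightarrow> 'a \<Rightarrow> real"
  assumes indep: "indep_vars (\<lambda>_. borel) Y UNIV"
    and nonneg: "\<And>k. AE x in M. 0 \<le> Y k x"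
    and sq: "\<And>k. integrable M (\<lambda>x. (Y k x)\<^sup>2)"
    and mean: "\<And>k. expectation (Y k) = c"
    and var: "\<And>k. variance (Y k) = v"
  shows "AE x in M. (\<lambda>n. (\<Sum>k<n. Y k x) / real n) \<longlonglongrightarrow> c"
proof -
  have rv [measurable]: "random_variable borel (Y k)" for k
    using indep by (auto simp: indep_vars_def)
  have int: "integrable M (Y k)" for k
    by (rule square_integrable_imp_integrable[OF rv sq])
  have v: "0 \<le> v" using variance_positive[of "Y 0"] var by simp
  let ?D = "\<lambda>k x. Y k x - c"
  have indepD: "indep_vars (\<lambda>_. borel) ?D {..<n}" for n
    by (rule indep_vars_compose2[where Y="\<lambda>_ y. y - c", OF indep_vars_subset[OF indep]]) auto
  have sqD: "integrable M (\<lambda>x. (?D k x)\<^sup>2)" for k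
    using sq int by (auto simp: power2_diff)
  have zeroD: "expectation (?D k) = 0" for k
    using int mean by (simp add: prob_space)
  have sum_sq: "integrable M (\<lambda>x. (\<Sum>k<n. ?D k x)\<^sup>2)"
    "expectation (\<lambda>x. (\<Sum>k<n. ?D k x)\<^sup>2) = real n * v" for n
  proof -
    show "integrable M (\<lambda>x. (\<Sum>k<n. ?D k x)\<^sup>2)"
      using indepD sqD zeroD by (intro integrable_square_sum_indep) auto
    have "expectation (\<lambda>x. (\<Sum>k<n. ?D k x)\<^sup>2) = (\<Sum>k<n. expectation (\<lambda>x. (?D k x)\<^sup>2))"
      using indepD sqD zeroD by (intro expectation_square_sum_indep) auto
    also have "\<dots> = real n * v"
      using var mean by simp
    finally show "expectation (\<lambda>x. (\<Sum>k<n. ?D k x)\<^sup>2) = real n * v" .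
  qed
  define f where "f n x = (\<Sum>k<n\<^sup>2. ?D k x)\<^sup>2 / (real (n\<^sup>2))\<^sup>2" for n x
  have "AE x in M. (\<lambda>n. f n x) \<longlonglongrightarrow> 0"
  proof (rule AE_tendsto_zero_of_summable_integrals)
    show "f n \<in> borel_measurable M" for n unfolding f_def by measurable
    show "0 \<le> f n x" for n x by (simp add: f_def)
    \<comment> \<open>At \<open>n = 0\<close> both sides are 0, since division by zero yields
      0.\<close>
    show "(\<integral>\<^sup>+ x. ennreal (f n x) \<partial>M) \<le> ennreal (v * (1 / real n ^ 2))" for n
    proof -
      have "(\<integral>\<^sup>+ x. ennreal (f n x) \<partial>M) = ennreal (expectation (f n))"
        unfolding f_def using sum_sq(1) by (intro nn_integral_eq_integral) auto
      also have "expectation (f n) = real (n\<^sup>2) * v / (real (n\<^sup>2))\<^sup>2"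
        unfolding f_def by (simp add: sum_sq(2) del: of_nat_power)
      also have "\<dots> = v * (1 / real n ^ 2)"
        by (simp add: power2_eq_square)
      finally show ?thesis by simp
    qed
    show "0 \<le> v * (1 / real n ^ 2)" for n using v by simp
    show "summable (\<lambda>n. v * (1 / real n ^ 2))"
      using inverse_power_summable[of 2, where 'a=real] by (intro summable_mult) (simp add: inverse_eq_divide)
  qed
  moreover have "AE x in M. \<forall>k. 0 \<le> Y k x"
    using nonneg by (simp add: AE_all_countable)
  ultimately show ?thesis
  proof eventually_elim
    case (elim x)
    have "(\<lambda>n. sqrt (f n x)) \<longlonglongrightarrow> sqrt 0"
      using elim by (intro tendsto_real_sqrt)
    then have "(\<lambda>n. \<bar>(\<Sum>k<n\<^sup>2. ?D k x) / real (n\<^sup>2)\<bar>) \<longlonglongrightarrow> 0"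
      by (simp add: f_def real_sqrt_divide del: of_nat_power)
    then have "(\<lambda>n. (\<Sum>k<n\<^sup>2. ?D k x) / real (n\<^sup>2)) \<longlonglongrightarrow> 0"
      by (rule tendsto_rabs_zero_cancel)
    then have "(\<lambda>n. (\<Sum>k<n\<^sup>2. ?D k x) / real (n\<^sup>2) + c) \<longlonglongrightarrow> 0 + c"
      by (intro tendsto_intros)
    then have "(\<lambda>n. (\<Sum>k<n\<^sup>2. Y k x) / real (n\<^sup>2)) \<longlonglongrightarrow> 0 + c"
    proof (rule Lim_transform_eventually)
      show "\<forall>\<^sub>F n in sequentially. (\<Sum>k<n\<^sup>2. ?D k x) / real (n\<^sup>2) + c = (\<Sum>k<n\<^sup>2. Y k x) / real (n\<^sup>2)"
        using eventually_gt_at_top[of 0]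
        by eventually_elim (simp add: sum_subtractf field_simps)
    qed
    then show ?case
      using elim(2) by (intro averages_tendsto_of_square_averages) auto
  qed
qed

section \<open>Offspring laws\<close>

lemma AE_pmf_ge_1:
  fixes q :: "nat pmf"
  assumes "pmf q 0 = 0"
  shows "AE k in q. 1 \<le> k"
  using assms by (auto simp: AE_measure_pmf_iff set_pmf_iff Suc_le_eq intro!: gr0I)

lemma expectation_pmf_ge_1:
  assumes "integrable (measure_pmf q) real" and "pmf q 0 = 0"
  shows "1 \<le> measure_pmf.expectation q real"
proof -
  have "measure_pmf.expectation q (\<lambda>_. 1) \<le> measure_pmf.expectation q real"
    using assms(1) AE_pmf_ge_1[OF assms(2)] by (intro integral_mono_AE) auto
  then show ?thesis by simp
qed

text \<open>Rewriting \<open>q\<close> as a density with respect to counting measure turns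
  expectations into series. This connects the series in \<open>offspring_mean\<close> with integrals
  under the offspring law.\<close>

lemma summable_pmf_nat:
  fixes f :: "nat \<Rightarrow> real"
  shows integrable_pmf_nat_iff: "integrable (measure_pmf q) f \<longleftrightarrow> summable (\<lambda>k. norm (pmf q k * f k))"
    and expectation_pmf_nat: "integrable (measure_pmf q) f \<Longrightarrow>
      measure_pmf.expectation q f = (\<Sum>k. pmf q k * f k)"
proof -
  have *: "integrable (measure_pmf q) f \<longleftrightarrow> integrable (count_space UNIV) (\<lambda>k. pmf q k * f k)"
    unfolding measure_pmf_eq_density by (subst integrable_density) auto
  then show "integrable (measure_pmf q) f \<longleftrightarrow> summable (\<lambda>k. norm (pmf q k * f k))"
    by (simp add: integrable_count_space_nat_iff)
  assume "integrable (measure_pmf q) f"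
  with * have "integrable (count_space UNIV) (\<lambda>k. pmf q k * f k)" by simp
  moreover have "measure_pmf.expectation q f = integral\<^sup>L (count_space UNIV) (\<lambda>k. pmf q k * f k)"
    unfolding measure_pmf_eq_density by (subst integral_density) auto
  ultimately show "measure_pmf.expectation q f = (\<Sum>k. pmf q k * f k)"
    by (simp add: integral_count_space_nat)
qed

text \<open>The degenerate law is the case that supercriticality must exclude: if it occurred in
  almost every environment, the mean of \<open>ln m_0\<close> would be 0.\<close>

lemma expectation_pmf_eq_1:
  assumes "pmf q 1 = 1"
  shows "measure_pmf.expectation q real = 1"
proof -
  have "measure_pmf.prob q {1} = 1" using assms by (simp add: pmf.rep_eq)
  then have "AE k in q. k \<in> {1}" by (rule measure_pmf.AE_prob_1)
  then have "measure_pmf.expectation q real = measure_pmf.expectation q (\<lambda>_. 1)"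
    by (intro integral_cong_AE) auto
  then show ?thesis by simp
qed

text \<open>The value \<open>1 / k\<close> is at most 1/2 except at \<open>k = 1\<close>, where it
  is 1; at \<open>k = 0\<close> it is 0 by the convention for division.\<close>

lemma nn_integral_inverse_pmf_le:
  fixes q :: "nat pmf"
  shows "(\<integral>\<^sup>+ k. ennreal (1 / real k) \<partial>q) \<le> ennreal ((1 + pmf q 1) / 2)"
proof -
  have "(\<integral>\<^sup>+ k. ennreal (1 / real k) \<partial>q) \<le> (\<integral>\<^sup>+ k. ennreal (1 / 2 + indicator {1} k / 2) \<partial>q)"
  proof (intro nn_integral_mono ennreal_leI)
    fix k :: nat
    consider "k = 0" | "k = 1" | "2 \<le> k" by linarith
    then show "1 / real k \<le> 1 / 2 + indicator {1} k / 2"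
      by cases (auto simp: divide_simps)
  qed
  also have "\<dots> = ennreal (measure_pmf.expectation q (\<lambda>k. 1 / 2 + indicator {1} k / 2))"
    by (intro nn_integral_eq_integral measure_pmf.integrable_const_bound[where B=1])
       (auto intro!: AE_I2 simp: indicator_def)
  also have "measure_pmf.expectation q (\<lambda>k. 1 / 2 + indicator {1} k / 2) = (1 + pmf q 1) / 2"
  proof -
    have "measure_pmf.expectation q (\<lambda>k. 1 / 2 + indicator {1} k / 2) = 1 / 2 + pmf q 1 / 2"
      by (subst Bochner_Integration.integral_add)
         (auto simp: pmf.rep_eq indicator_le_1
           intro!: AE_I2 measure_pmf.integrable_const_bound[where B=1] order_trans[OF indicator_le_1])
    then show ?thesis by (simp add: add_divide_distrib)
  qed
  finally show ?thesis .
qed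

text \<open>Large values are capped at \<open>K\<close> rather than discarded. A positive offspring
  number thus stays positive, so that without death and for \<open>K\<close> at least 1 the
  logarithm of the truncated mean is nonnegative.\<close>

definition truncated_mean :: "nat \<Rightarrow> nat pmf \<Rightarrow> real" where
  "truncated_mean K q = measure_pmf.expectation q (\<lambda>k. real (min k K))"

lemma truncated_mean_ge_1:
  assumes "1 \<le> K" and "pmf q 0 = 0"
  shows "1 \<le> truncated_mean K q"
proof -
  have "AE k in q. 1 \<le> real (min k K)"
    using AE_pmf_ge_1[OF assms(2)] by eventually_elim (use assms(1) in auto)
  then have "measure_pmf.expectation q (\<lambda>_. 1) \<le> truncated_mean K q"
    unfolding truncated_mean_def
    by (intro integral_mono_AE measure_pmf.integrable_const_bound[where B = "real K"]) auto
  then show ?thesis by simp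
qed

lemma truncated_mean_le: "truncated_mean K q \<le> real K"
proof -
  have "truncated_mean K q \<le> measure_pmf.expectation q (\<lambda>_. real K)"
    unfolding truncated_mean_def
    by (intro integral_mono measure_pmf.integrable_const_bound[where B = "real K"]) auto
  then show ?thesis by simp
qed

lemma truncated_mean_measurable:
  assumes [measurable]: "\<And>k. (\<lambda>e. pmf (p e) k) \<in> borel_measurable N"
  shows "(\<lambda>e. truncated_mean K (p e)) \<in> borel_measurable N"
proof -
  \<comment> \<open>Measurability in the environment is known for the point masses only, so the
    expectation is written as a series in them.\<close>
  have "truncated_mean K (p e) = (\<Sum>k. pmf (p e) k * real (min k K))" for e
    unfolding truncated_mean_def
    by (intro expectation_pmf_nat measure_pmf.integrable_const_bound[where B = "real K"]) auto
  then show ?thesis by simp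
qed

lemma truncated_mean_le_mean:
  "integrable (measure_pmf q) real \<Longrightarrow> truncated_mean K q \<le> measure_pmf.expectation q real"
  unfolding truncated_mean_def
  by (rule integral_mono) (auto intro!: measure_pmf.integrable_const_bound[where B = "real K"])

lemma truncated_mean_tendsto:
  assumes "integrable (measure_pmf q) real"
  shows "(\<lambda>K. truncated_mean K q) \<longlonglongrightarrow> measure_pmf.expectation q real"
  unfolding truncated_mean_def
proof (rule integral_dominated_convergence[OF _ _ assms])
  show "AE k in q. (\<lambda>K. real (min k K)) \<longlonglongrightarrow> real k"
  proof (rule AE_I2)
    fix k
    have "\<forall>\<^sub>F K in sequentially. real (min k K) = real k"
      using eventually_ge_at_top[of k] by eventually_elim simp
    then show "(\<lambda>K. real (min k K)) \<longlonglongrightarrow> real k"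
      by (rule tendsto_eventually)
  qed
qed auto

section \<open>The quenched process\<close>

text \<open>The increments telescope from some index on, and the constant left over from the initial
  stretch disappears after division by \<open>n\<close>. With \<open>a n = ln (Z n)\<close> this
  turns growth in one step into a linear rate.\<close>

lemma eventually_average_ge:
  fixes a b :: "nat \<Rightarrow> real"
  assumes step: "\<forall>\<^sub>F n in sequentially. a n + b n \<le> a (Suc n)"
    and lim: "(\<lambda>n. (\<Sum>k<n. b k) / real n) \<longlonglongrightarrow> \<beta>" and y: "y < \<beta>"
  shows "\<forall>\<^sub>F n in sequentially. y < a n / real n"
proof -
  obtain m where m: "\<And>n. n \<ge> m \<Longrightarrow> a n + b n \<le> a (Suc n)"
    using step by (auto simp: eventually_sequentially)
  \<comment> \<open>Chosen so that the lower bound for \<open>a n\<close> is an equality at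
    \<open>n = m\<close>, where the induction starts.\<close>
  define C where "C = a m - (\<Sum>k<m. b k)"
  have ge: "C + (\<Sum>k<n. b k) \<le> a n" if "n \<ge> m" for n
    using that
  proof (induction n rule: dec_induct)
    case (step n)
    then show ?case using m[of n] by simp
  qed (simp add: C_def)
  have "(\<lambda>n. C / real n + (\<Sum>k<n. b k) / real n) \<longlonglongrightarrow> 0 + \<beta>"
    by (intro tendsto_add lim lim_const_over_n)
  then have "\<forall>\<^sub>F n in sequentially. y < C / real n + (\<Sum>k<n. b k) / real n"
    using y by (intro order_tendstoD) auto
  then show ?thesis
    using eventually_ge_at_top[of m] 
  proof eventually_elim
    case (elim n)
    have "(C + (\<Sum>k<n. b k)) / real n \<le> a n / real n"
      using ge[OF elim(2)] by (intro divide_right_mono) auto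
    with elim(1) show ?case by (simp add: add_divide_distrib)
  qed
qed

text \<open>Since \<open>(1 + u) / 2 = 1 - (1 - u) / 2\<close> is at most
  \<open>exp (- (1 - u) / 2)\<close>, the product is at most the exponential of minus half the sum
  of the \<open>1 - u k\<close>. That sum eventually exceeds \<open>n * c / 2\<close>, which gives
  the geometric ratio \<open>exp (- c / 4)\<close>.\<close>

lemma summable_prod_of_average:
  fixes u :: "nat \<Rightarrow> real"
  assumes u: "\<And>k. 0 \<le> u k" "\<And>k. u k \<le> 1"
    and lim: "(\<lambda>n. (\<Sum>k<n. 1 - u k) / real n) \<longlonglongrightarrow> c" and c: "0 < c"
  shows "summable (\<lambda>n. \<Prod>k<n. (1 + u k) / 2)"
proof (rule summable_comparison_test_ev)
  show "summable (\<lambda>n. exp (- c / 4) ^ n)"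
    using c by (intro summable_geometric) simp
  have "\<forall>\<^sub>F n in sequentially. c / 2 < (\<Sum>k<n. 1 - u k) / real n"
    using c by (intro order_tendstoD[OF lim]) auto
  then show "\<forall>\<^sub>F n in sequentially. norm (\<Prod>k<n. (1 + u k) / 2) \<le> exp (- c / 4) ^ n"
    using eventually_gt_at_top[of 0]
  proof eventually_elim
    case (elim n)
    have "(\<Prod>k<n. (1 + u k) / 2) \<le> (\<Prod>k<n. exp (- (1 - u k) / 2))"
    proof (intro prod_mono conjI)
      fix k
      show "0 \<le> (1 + u k) / 2" using u(1)[of k] by simp
      show "(1 + u k) / 2 \<le> exp (- (1 - u k) / 2)"
        using exp_ge_add_one_self[of "- (1 - u k) / 2"] by (simp add: field_simps)
    qed
    also have "\<dots> = exp (- (\<Sum>k<n. 1 - u k) / 2)"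
      by (simp add: exp_sum[symmetric] sum_negf sum_divide_distrib[symmetric] del: minus_diff_eq)
    also have "\<dots> \<le> exp (real n * (- c / 4))"
      using elim by (simp add: field_simps)
    also have "\<dots> = exp (- c / 4) ^ n"
      by (rule exp_of_nat_mult)
    finally show ?case
      using u(1) by (simp add: prod_nonneg add_nonneg_nonneg)
  qed
qed

text \<open>The inequality between harmonic and arithmetic means, obtained from Cauchy-Schwarz for
  the vectors with entries \<open>sqrt (w i)\<close> and \<open>1 / sqrt (w i)\<close>. The
  right-hand side is linear in the reciprocals, so expectations can be taken term by term.\<close>

lemma inverse_sum_le:
  fixes w :: "nat \<Rightarrow> nat"
  assumes "1 \<le> z" and w: "\<And>i. 1 \<le> i \<Longrightarrow> 1 \<le> w i"
  shows "1 / real (\<Sum>i = 1..z. w i) \<le> (1 / (real z)\<^sup>2) * (\<Sum>i = 1..z. 1 / real (w i))"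
proof -
  have "(\<Sum>i = 1..z. sqrt (real (w i)) * sqrt (1 / real (w i)))\<^sup>2
      \<le> (\<Sum>i = 1..z. (sqrt (real (w i)))\<^sup>2) * (\<Sum>i = 1..z. (sqrt (1 / real (w i)))\<^sup>2)"
    by (rule Cauchy_Schwarz_ineq_sum)
  also have "(\<Sum>i = 1..z. sqrt (real (w i)) * sqrt (1 / real (w i))) = (\<Sum>i = 1..z. 1)"
    using w by (intro sum.cong refl) (fastforce simp: real_sqrt_mult[symmetric])
  finally have CS: "(real z)\<^sup>2 \<le> real (\<Sum>i = 1..z. w i) * (\<Sum>i = 1..z. 1 / real (w i))"
    by simp
  have "w 1 \<le> (\<Sum>i = 1..z. w i)"
    using \<open>1 \<le> z\<close> by (intro member_le_sum) auto
  with w[of 1] have "0 < (\<Sum>i = 1..z. w i)"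
    by linarith
  then have "0 < real (\<Sum>i = 1..z. w i)" by (simp only: of_nat_0_less_iff)
  moreover have "0 < (real z)\<^sup>2" using assms by simp
  moreover have "1 / s \<le> 1 / y * t" if "0 < s" "0 < y" "y \<le> s * t" for s t y :: real
    using that by (simp add: divide_simps mult.commute)
  ultimately show ?thesis using CS by blast
qed

text \<open>The number of summands is itself random; it takes countably many values, and for each
  fixed value the sum is measurable by induction on its length.\<close>

lemma gen_size_measurable:
  assumes X: "\<And>n i. 1 \<le> i \<Longrightarrow> X n i \<in> M \<rightarrow>\<^sub>M count_space UNIV"
  shows "gen_size X n \<in> M \<rightarrow>\<^sub>M count_space UNIV"
proof (induction n)
  case (Suc n)
  note [measurable] = this
  have "(\<lambda>x. \<Sum>i = 1..z. X n i x) \<in> M \<rightarrow>\<^sub>M count_space UNIV" for z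
  proof (induction z)
    case (Suc z)
    note [measurable] = this X[of "Suc z" n, simplified]
    have "(\<lambda>x. (\<lambda>a x. a + X n (Suc z) x) (\<Sum>i = 1..z. X n i x) x) \<in> M \<rightarrow>\<^sub>M count_space UNIV"
      by (rule measurable_compose_countable[OF _ Suc]) measurable
    then show ?case by simp
  qed simp
  then have "(\<lambda>x. (\<lambda>z x. \<Sum>i = 1..z. X n i x) (gen_size X n x) x) \<in> M \<rightarrow>\<^sub>M count_space UNIV"
    by (rule measurable_compose_countable) fact
  then show ?case by simp
qed simp

text \<open>The quenched process for one fixed environment \<xi>: \<open>M\<close> stands for
  \<open>Q \<xi>\<close> and \<open>q n\<close> for \<open>p (\<xi> n)\<close>. Here no randomness
  of the environment is left.\<close>

locale branching_process = prob_space M for M :: "'x measure" +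
  fixes q :: "nat \<Rightarrow> nat pmf" and X :: "nat \<Rightarrow> nat \<Rightarrow> 'x \<Rightarrow> nat"
  assumes offspring_measurable: "\<And>n i. 1 \<le> i \<Longrightarrow> X n i \<in> M \<rightarrow>\<^sub>M count_space UNIV"
    and offspring_law: "\<And>n i k. 1 \<le> i \<Longrightarrow> prob {x \<in> space M. X n i x = k} = pmf (q n) k"
    and offspring_indep: "\<And>n. indep_vars (\<lambda>_. count_space UNIV) (X n) {1..}"
    and offspring_indep_past: "\<And>n. indep_var
      (\<Pi>\<^sub>M i\<in>{1..}. count_space UNIV) (\<lambda>x. \<lambda>i\<in>{1..}. X n i x)
      (\<Pi>\<^sub>M j\<in>{1..n}. count_space UNIV) (\<lambda>x. \<lambda>j\<in>{1..n}. gen_size X j x)"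
    and no_death: "\<And>n. pmf (q n) 0 = 0"
    and finite_mean: "\<And>n. integrable (q n) real"
begin

abbreviation Z :: "nat \<Rightarrow> 'x \<Rightarrow> nat" where
  "Z n \<equiv> gen_size X n"

abbreviation mean :: "nat \<Rightarrow> real" where
  "mean n \<equiv> measure_pmf.expectation (q n) real"

section \<open>Offspring laws under the quenched measure\<close>

lemma distr_offspring:
  assumes i: "1 \<le> i"
  shows "distr M (count_space UNIV) (X n i) = measure_pmf (q n)"
proof (rule measure_eqI_countable[where A=UNIV])
  note [measurable] = offspring_measurable[OF i]
  fix k :: nat
  have "emeasure (distr M (count_space UNIV) (X n i)) {k} = emeasure M {x \<in> space M. X n i x = k}"
    by (subst emeasure_distr) (auto intro!: arg_cong[where f="emeasure M"])
  also have "\<dots> = ennreal (pmf (q n) k)"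
    using offspring_law[OF i] by (simp add: emeasure_eq_measure)
  finally show "emeasure (distr M (count_space UNIV) (X n i)) {k} = emeasure (measure_pmf (q n)) {k}"
    by (simp add: emeasure_pmf_single)
qed auto

lemma nn_integral_offspring:
  "1 \<le> i \<Longrightarrow> (\<integral>\<^sup>+ x. g (X n i x) \<partial>M) = (\<integral>\<^sup>+ k. g k \<partial>q n)"
  by (subst distr_offspring[symmetric, of i n]) (auto simp: nn_integral_distr offspring_measurable)

lemma expectation_offspring:
  fixes g :: "nat \<Rightarrow> real"
  shows "1 \<le> i \<Longrightarrow> expectation (\<lambda>x. g (X n i x)) = measure_pmf.expectation (q n) g"
  by (subst distr_offspring[symmetric, of i n]) (auto simp: integral_distr offspring_measurable)

lemma AE_offspring_pos: "AE x in M. \<forall>n. \<forall>i\<ge>1. 1 \<le> X n i x"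
proof -
  have "AE x in M. 1 \<le> i \<longrightarrow> 1 \<le> X n i x" for n i
  proof (cases "1 \<le> i")
    case True
    have "AE k in distr M (count_space UNIV) (X n i). 1 \<le> k"
      unfolding distr_offspring[OF True] by (rule AE_pmf_ge_1[OF no_death])
    then show ?thesis
      using offspring_measurable[OF True] by (subst (asm) AE_distr_iff) auto
  qed simp
  then show ?thesis by (simp add: AE_all_countable)
qed

lemma AE_Z_pos: "AE x in M. \<forall>n. 1 \<le> Z n x"
  using AE_offspring_pos
proof eventually_elim
  case (elim x)
  have "1 \<le> Z n x" for n
  proof (induction n)
    case (Suc n)
    have "Z n x \<le> (\<Sum>i = 1..Z n x. X n i x)"
      using elim sum_mono[of "{1..Z n x}" "\<lambda>_. 1" "\<lambda>i. X n i x"] by simp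
    with Suc show ?case by simp
  qed simp
  then show ?case by blast
qed

lemma Z_measurable [measurable]: "Z n \<in> M \<rightarrow>\<^sub>M count_space UNIV"
  by (rule gen_size_measurable) (rule offspring_measurable)

text \<open>Plays the role of conditioning on \<open>Z n\<close>. The offspring of generation
  \<open>n\<close> are independent of the past sizes, so their joint law is a product and Fubini's
  theorem allows \<open>Z n\<close> to be frozen while the offspring are averaged.\<close>

lemma nn_integral_generation:
  fixes f :: "nat \<Rightarrow> (nat \<Rightarrow> nat) \<Rightarrow> ennreal"
  assumes [measurable]: "\<And>z. f z \<in> borel_measurable (\<Pi>\<^sub>M i\<in>{1..}. count_space UNIV)"
  shows "(\<integral>\<^sup>+ x. f (Z n x) (\<lambda>i\<in>{1..}. X n i x) \<partial>M)
    = (\<integral>\<^sup>+ x. (\<integral>\<^sup>+ y. f (Z n x) (\<lambda>i\<in>{1..}. X n i y) \<partial>M) \<partial>M)"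
proof -
  let ?S = "\<Pi>\<^sub>M i\<in>{1..}. count_space (UNIV :: nat set)"
  let ?T = "\<Pi>\<^sub>M j\<in>{1..n}. count_space (UNIV :: nat set)"
  let ?C = "count_space (UNIV :: nat set)"
  let ?Y = "\<lambda>x. \<lambda>i\<in>{1..}. X n i x"
  note [simp del] = One_nat_def
  let ?U = "\<lambda>x. \<lambda>j\<in>{1..n}. Z j x"
  \<comment> \<open>Reads \<open>Z n\<close> off the vector of past sizes. That vector is indexed
    from 1, so for \<open>n = 0\<close> it is empty and the constant \<open>Z 0 = 1\<close> is
    supplied.\<close>
  define h :: "(nat \<Rightarrow> nat) \<Rightarrow> nat" where "h = (if n = 0 then \<lambda>_. 1 else (\<lambda>w. w n))"
  have h [measurable]: "h \<in> ?T \<rightarrow>\<^sub>M ?C"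
    by (auto simp: h_def)
  have hU: "h (?U x) = Z n x" for x
    by (auto simp: h_def)
  have Ym [measurable]: "?Y \<in> M \<rightarrow>\<^sub>M ?S" and Um [measurable]: "?U \<in> M \<rightarrow>\<^sub>M ?T"
    and joint: "distr M (?S \<Otimes>\<^sub>M ?T) (\<lambda>x. (?Y x, ?U x)) = distr M ?S ?Y \<Otimes>\<^sub>M distr M ?T ?U"
    using offspring_indep_past[of n] by (auto simp: indep_var_distribution_eq)
  interpret Y: prob_space "distr M ?S ?Y" by (rule prob_space_distr) (rule Ym)
  interpret U: prob_space "distr M ?T ?U" by (rule prob_space_distr) (rule Um)
  interpret P: pair_sigma_finite "distr M ?S ?Y" "distr M ?T ?U" ..
  have fm: "(\<lambda>(w, u). f (h u) w) \<in> borel_measurable (?S \<Otimes>\<^sub>M ?T)"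
  proof -
    \<comment> \<open>Measurability for each fixed \<open>z\<close> gives joint measurability
      because \<open>z\<close> ranges over a countable set.\<close>
    have "(\<lambda>(z, w). f z w) \<in> borel_measurable (?C \<Otimes>\<^sub>M ?S)"
      by (intro measurable_pair_measure_countable1 countableI_type) (simp add: assms)
    then have "(\<lambda>wu. (\<lambda>(z, w). f z w) (h (snd wu), fst wu)) \<in> borel_measurable (?S \<Otimes>\<^sub>M ?T)"
      by (rule measurable_compose[rotated]) measurable
    then show ?thesis by (simp add: case_prod_beta')
  qed
  have "(\<integral>\<^sup>+ x. f (Z n x) (?Y x) \<partial>M)
      = (\<integral>\<^sup>+ (w, u). f (h u) w \<partial>distr M (?S \<Otimes>\<^sub>M ?T) (\<lambda>x. (?Y x, ?U x)))"
    using fm by (subst nn_integral_distr) (simp_all add: hU)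
  also have "\<dots> = (\<integral>\<^sup>+ u. \<integral>\<^sup>+ w. f (h u) w \<partial>distr M ?S ?Y \<partial>distr M ?T ?U)"
    unfolding joint using fm by (subst P.nn_integral_snd[symmetric]) auto
  also have "\<dots> = (\<integral>\<^sup>+ x. (\<integral>\<^sup>+ w. f (Z n x) w \<partial>distr M ?S ?Y) \<partial>M)"
    using measurable_compose[OF h, of "\<lambda>z. \<integral>\<^sup>+ w. f z w \<partial>distr M ?S ?Y" borel]
    by (subst nn_integral_distr) (simp_all add: hU)
  also have "\<dots> = (\<integral>\<^sup>+ x. (\<integral>\<^sup>+ y. f (Z n x) (?Y y) \<partial>M) \<partial>M)"
    by (subst nn_integral_distr) auto
  finally show ?thesis .
qed

section \<open>Expected generation sizes and expected reciprocals\<close>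

lemma mean_ge_1: "1 \<le> mean n"
  by (rule expectation_pmf_ge_1[OF finite_mean no_death])

text \<open>With \<open>Z n\<close> frozen, each of its individuals contributes
  \<open>mean n\<close> on average, so every generation multiplies the expectation by that
  factor.\<close>

lemma nn_integral_Z: "(\<integral>\<^sup>+ x. ennreal (real (Z n x)) \<partial>M) = ennreal (\<Prod>k<n. mean k)"
proof (induction n)
  case 0
  then show ?case by (simp add: emeasure_space_1)
next
  case (Suc n)
  have "(\<integral>\<^sup>+ x. ennreal (real (Z (Suc n) x)) \<partial>M)
      = (\<integral>\<^sup>+ x. (\<lambda>z w. \<Sum>i = 1..z. ennreal (real (w i))) (Z n x) (\<lambda>i\<in>{1..}. X n i x) \<partial>M)"
    by (intro nn_integral_cong) (simp add: sum_ennreal)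
  also have "\<dots> = (\<integral>\<^sup>+ x. (\<integral>\<^sup>+ y. (\<Sum>i = 1..Z n x. ennreal (real (X n i y))) \<partial>M) \<partial>M)"
    by (subst nn_integral_generation) (auto intro!: borel_measurable_sum)
  also have "\<dots> = (\<integral>\<^sup>+ x. ennreal (real (Z n x)) * ennreal (mean n) \<partial>M)"
  proof (intro nn_integral_cong)
    fix x
    have "(\<integral>\<^sup>+ y. (\<Sum>i = 1..Z n x. ennreal (real (X n i y))) \<partial>M)
        = (\<Sum>i = 1..Z n x. \<integral>\<^sup>+ y. ennreal (real (X n i y)) \<partial>M)"
      using offspring_measurable by (intro nn_integral_sum) auto
    also have "\<dots> = (\<Sum>i = 1..Z n x. ennreal (mean n))"
    proof (intro sum.cong refl)
      fix i assume "i \<in> {1..Z n x}"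
      then have "(\<integral>\<^sup>+ y. ennreal (real (X n i y)) \<partial>M) = (\<integral>\<^sup>+ k. ennreal (real k) \<partial>q n)"
        by (intro nn_integral_offspring) simp
      also have "\<dots> = ennreal (mean n)"
        using finite_mean by (intro nn_integral_eq_integral) auto
      finally show "(\<integral>\<^sup>+ y. ennreal (real (X n i y)) \<partial>M) = ennreal (mean n)" .
    qed
    finally show "(\<integral>\<^sup>+ y. (\<Sum>i = 1..Z n x. ennreal (real (X n i y))) \<partial>M)
        = ennreal (real (Z n x)) * ennreal (mean n)"
      by (simp add: ennreal_of_nat_eq_real_of_nat)
  qed
  also have "\<dots> = ennreal (\<Prod>k<n. mean k) * ennreal (mean n)"
    by (subst nn_integral_multc) (auto simp: Suc)
  also have "\<dots> = ennreal (\<Prod>k<Suc n. mean k)"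
    using mean_ge_1 by (subst ennreal_mult[symmetric]) (auto intro!: prod_nonneg order_trans[OF _ mean_ge_1])
  finally show ?case .
qed

text \<open>With \<open>Z n = z\<close> frozen, the harmonic-arithmetic inequality bounds the mean
  of \<open>1 / Z (Suc n)\<close> by \<open>1 / z^2\<close> times \<open>z\<close> expected
  reciprocals of offspring numbers, each at most \<open>(1 + pmf (q n) 1) / 2\<close>. One factor
  \<open>1 / z\<close> remains and the recursion closes.\<close>

lemma nn_integral_inverse_Z:
  "(\<integral>\<^sup>+ x. ennreal (1 / real (Z n x)) \<partial>M) \<le> ennreal (\<Prod>k<n. (1 + pmf (q k) 1) / 2)"
proof (induction n)
  case 0
  then show ?case by (simp add: emeasure_space_1)
next
  case (Suc n)
  let ?r = "(1 + pmf (q n) 1) / 2"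
  let ?f = "\<lambda>z (w :: nat \<Rightarrow> nat). \<Sum>i = 1..z. ennreal (1 / (real z)\<^sup>2) * ennreal (1 / real (w i))"
  have "(\<integral>\<^sup>+ x. ennreal (1 / real (Z (Suc n) x)) \<partial>M)
      \<le> (\<integral>\<^sup>+ x. ?f (Z n x) (\<lambda>i\<in>{1..}. X n i x) \<partial>M)"
    using AE_Z_pos AE_offspring_pos
  proof (intro nn_integral_mono_AE, eventually_elim)
    case (elim x)
    have "1 / real (Z (Suc n) x) \<le> (1 / (real (Z n x))\<^sup>2) * (\<Sum>i = 1..Z n x. 1 / real (X n i x))"
      using elim by (simp only: gen_size.simps) (intro inverse_sum_le, auto)
    also have "\<dots> = (\<Sum>i = 1..Z n x. (1 / (real (Z n x))\<^sup>2) * (1 / real (X n i x)))"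
      by (rule sum_distrib_left)
    finally have "ennreal (1 / real (Z (Suc n) x))
        \<le> (\<Sum>i = 1..Z n x. ennreal ((1 / (real (Z n x))\<^sup>2) * (1 / real (X n i x))))"
      by (subst sum_ennreal) (auto intro: ennreal_leI)
    also have "\<dots> = ?f (Z n x) (\<lambda>i\<in>{1..}. X n i x)"
      by (intro sum.cong refl) (simp add: ennreal_mult[symmetric])
    finally show ?case .
  qed
  also have "\<dots> = (\<integral>\<^sup>+ x. (\<integral>\<^sup>+ y. ?f (Z n x) (\<lambda>i\<in>{1..}. X n i y) \<partial>M) \<partial>M)"
    by (rule nn_integral_generation) (auto intro!: borel_measurable_sum borel_measurable_times)
  also have "\<dots> \<le> (\<integral>\<^sup>+ x. ennreal (1 / real (Z n x)) * ennreal ?r \<partial>M)"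
  proof (intro nn_integral_mono)
    fix x
    let ?z = "Z n x"
    have Xm: "(\<lambda>y. ennreal (1 / real (X n i y))) \<in> borel_measurable M" if "1 \<le> i" for i
      by (rule measurable_compose[OF offspring_measurable[OF that]]) simp
    have "(\<integral>\<^sup>+ y. ?f ?z (\<lambda>i\<in>{1..}. X n i y) \<partial>M)
        = (\<integral>\<^sup>+ y. (\<Sum>i = 1..?z. ennreal (1 / (real ?z)\<^sup>2) * ennreal (1 / real (X n i y))) \<partial>M)"
      by simp
    also have "\<dots> = (\<Sum>i = 1..?z. \<integral>\<^sup>+ y. ennreal (1 / (real ?z)\<^sup>2) * ennreal (1 / real (X n i y)) \<partial>M)"
      using Xm by (intro nn_integral_sum borel_measurable_times) auto
    also have "\<dots> = (\<Sum>i = 1..?z. ennreal (1 / (real ?z)\<^sup>2) * (\<integral>\<^sup>+ y. ennreal (1 / real (X n i y)) \<partial>M))"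
      using Xm by (intro sum.cong refl nn_integral_cmult) auto
    also have "\<dots> \<le> (\<Sum>i = 1..?z. ennreal (1 / (real ?z)\<^sup>2) * ennreal ?r)"
    proof (intro sum_mono mult_left_mono)
      fix i assume "i \<in> {1..?z}"
      then have "(\<integral>\<^sup>+ y. ennreal (1 / real (X n i y)) \<partial>M) = (\<integral>\<^sup>+ k. ennreal (1 / real k) \<partial>q n)"
        by (intro nn_integral_offspring) simp
      then show "(\<integral>\<^sup>+ y. ennreal (1 / real (X n i y)) \<partial>M) \<le> ennreal ?r"
        using nn_integral_inverse_pmf_le by simp
    qed simp
    also have "\<dots> = ennreal (real ?z * (1 / (real ?z)\<^sup>2) * ?r)"
    proof -
      have "(\<Sum>i = 1..?z. ennreal a * ennreal r) = ennreal (real ?z * a * r)"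
        if "0 \<le> a" "0 \<le> r" for a r
        using that by (simp add: ennreal_mult ennreal_of_nat_eq_real_of_nat mult.assoc)
      then show ?thesis by simp
    qed
    \<comment> \<open>Valid at \<open>?z = 0\<close> as well, where both sides are 0.\<close>
    also have "real ?z * (1 / (real ?z)\<^sup>2) = 1 / real ?z"
      by (simp add: power2_eq_square)
    also have "ennreal (1 / real ?z * ?r) = ennreal (1 / real ?z) * ennreal ?r"
      by (rule ennreal_mult) auto
    finally show "(\<integral>\<^sup>+ y. ?f ?z (\<lambda>i\<in>{1..}. X n i y) \<partial>M) \<le> ennreal (1 / real ?z) * ennreal ?r" .
  qed
  also have "\<dots> = (\<integral>\<^sup>+ x. ennreal (1 / real (Z n x)) \<partial>M) * ennreal ?r"
    by (rule nn_integral_multc) simp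
  also have "\<dots> \<le> ennreal (\<Prod>k<n. (1 + pmf (q k) 1) / 2) * ennreal ?r"
    by (intro mult_right_mono Suc) simp
  also have "\<dots> = ennreal (\<Prod>k<Suc n. (1 + pmf (q k) 1) / 2)"
    by (subst ennreal_mult[symmetric]) (auto intro!: prod_nonneg)
  finally show ?case .
qed

text \<open>Chebyshev's inequality for \<open>z\<close> independent centred variables bounded by
  \<open>K\<close>: the variance of their sum is at most \<open>z * K^2\<close> and the deviation
  exceeds \<epsilon> times \<open>z\<close>. The probability is written as an integral of an
  indicator so that it can be inserted into \<open>nn_integral_generation\<close>.\<close>

lemma prob_truncated_generation_small:
  assumes K: "1 \<le> K" and \<epsilon>: "0 < \<epsilon>" and z: "1 \<le> z"
  shows "(\<integral>\<^sup>+ y. of_bool (real (\<Sum>i = 1..z. min (X n i y) K) < (1 - \<epsilon>) * real z * truncated_mean K (q n)) \<partial>M)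
    \<le> ennreal ((real K)\<^sup>2 / \<epsilon>\<^sup>2 * (1 / real z))"
proof -
  let ?m = "truncated_mean K (q n)"
  let ?g = "\<lambda>k. real (min k K) - ?m"
  let ?Y = "\<lambda>i y. ?g (X n i y)"
  have m: "1 \<le> ?m" "?m \<le> real K"
    using truncated_mean_ge_1[OF K no_death] truncated_mean_le by auto
  have g: "\<bar>?g k\<bar> \<le> real K" for k using m by auto
  have g_sq: "(?g k)\<^sup>2 \<le> (real K)\<^sup>2" for k
    using g[of k] by (simp add: abs_le_square_iff[symmetric])
  have indep: "indep_vars (\<lambda>_. borel) ?Y {1..z}"
    by (rule indep_vars_compose2[where Y="\<lambda>_. ?g", OF indep_vars_subset[OF offspring_indep]]) auto
  have Ym: "?Y i \<in> borel_measurable M" if "i \<in> {1..z}" for i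
    using indep that by (auto simp: indep_vars_def)
  have sq: "integrable M (\<lambda>y. (?Y i y)\<^sup>2)" if "i \<in> {1..z}" for i
    using Ym[OF that] g_sq by (intro integrable_const_bound[where B = "(real K)\<^sup>2"]) auto
  have zero: "expectation (?Y i) = 0" if "i \<in> {1..z}" for i
  proof -
    have "expectation (?Y i) = measure_pmf.expectation (q n) ?g"
      using that by (intro expectation_offspring) simp
    also have "\<dots> = 0"
      unfolding truncated_mean_def
      by (subst Bochner_Integration.integral_diff)
         (auto intro!: measure_pmf.integrable_const_bound[where B = "real K"])
    finally show ?thesis .
  qed
  have "(\<integral>\<^sup>+ y. of_bool (real (\<Sum>i = 1..z. min (X n i y) K) < (1 - \<epsilon>) * real z * ?m) \<partial>M)
      \<le> (\<integral>\<^sup>+ y. ennreal ((\<Sum>i = 1..z. ?Y i y)\<^sup>2 / (\<epsilon> * real z)\<^sup>2) \<partial>M)"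
  proof (intro nn_integral_mono)
    fix y
    show "of_bool (real (\<Sum>i = 1..z. min (X n i y) K) < (1 - \<epsilon>) * real z * ?m)
      \<le> ennreal ((\<Sum>i = 1..z. ?Y i y)\<^sup>2 / (\<epsilon> * real z)\<^sup>2)"
    proof (cases "real (\<Sum>i = 1..z. min (X n i y) K) < (1 - \<epsilon>) * real z * ?m")
      case True
      then have "(\<Sum>i = 1..z. ?Y i y) < - (\<epsilon> * real z * ?m)"
        by (simp add: sum_subtractf algebra_simps)
      moreover have "\<epsilon> * real z * 1 \<le> \<epsilon> * real z * ?m"
        using m \<epsilon> by (intro mult_left_mono) auto
      ultimately have "\<bar>\<epsilon> * real z\<bar> \<le> \<bar>\<Sum>i = 1..z. ?Y i y\<bar>"
        using mult_pos_pos[of \<epsilon> "real z"] \<epsilon> z by linarith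
      then have "(\<epsilon> * real z)\<^sup>2 \<le> (\<Sum>i = 1..z. ?Y i y)\<^sup>2"
        by (simp only: abs_le_square_iff)
      then have "1 \<le> (\<Sum>i = 1..z. ?Y i y)\<^sup>2 / (\<epsilon> * real z)\<^sup>2"
        using \<epsilon> z by (subst pos_le_divide_eq) auto
      from ennreal_leI[OF this] show ?thesis using True by simp
    qed simp
  qed
  also have "\<dots> = ennreal (expectation (\<lambda>y. (\<Sum>i = 1..z. ?Y i y)\<^sup>2 / (\<epsilon> * real z)\<^sup>2))"
    using indep sq zero
    by (intro nn_integral_eq_integral integrable_divide integrable_square_sum_indep) auto
  also have "\<dots> \<le> ennreal ((real K)\<^sup>2 / \<epsilon>\<^sup>2 * (1 / real z))"
  proof (rule ennreal_leI)
    have "expectation (\<lambda>y. (\<Sum>i = 1..z. ?Y i y)\<^sup>2) = (\<Sum>i = 1..z. expectation (\<lambda>y. (?Y i y)\<^sup>2))"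
      using indep sq zero by (intro expectation_square_sum_indep) auto
    also have "\<dots> \<le> (\<Sum>i = 1..z. (real K)\<^sup>2)"
    proof (rule sum_mono)
      fix i assume "i \<in> {1..z}"
      then have "expectation (\<lambda>y. (?Y i y)\<^sup>2) \<le> expectation (\<lambda>_. (real K)\<^sup>2)"
        using sq g_sq by (intro integral_mono) auto
      then show "expectation (\<lambda>y. (?Y i y)\<^sup>2) \<le> (real K)\<^sup>2" by (simp add: prob_space)
    qed
    finally have "expectation (\<lambda>y. (\<Sum>i = 1..z. ?Y i y)\<^sup>2) \<le> real z * (real K)\<^sup>2"
      by simp
    then have "expectation (\<lambda>y. (\<Sum>i = 1..z. ?Y i y)\<^sup>2) / (\<epsilon> * real z)\<^sup>2
        \<le> real z * (real K)\<^sup>2 / (\<epsilon> * real z)\<^sup>2"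
      by (rule divide_right_mono) simp
    also have "\<dots> = (real K)\<^sup>2 / \<epsilon>\<^sup>2 * (1 / real z)"
      using z \<epsilon> by (simp add: power2_eq_square field_simps)
    finally show "expectation (\<lambda>y. (\<Sum>i = 1..z. ?Y i y)\<^sup>2 / (\<epsilon> * real z)\<^sup>2)
        \<le> (real K)\<^sup>2 / \<epsilon>\<^sup>2 * (1 / real z)" by simp
  qed
  finally show ?thesis .
qed

text \<open>Given \<open>Z n\<close>, a bad step has probability at most a constant over
  \<open>Z n\<close>. The expectations of \<open>1 / Z n\<close> are summable by
  \<open>nn_integral_inverse_Z\<close> and the hypothesis, so almost surely only finitely many steps
  are bad.\<close>

lemma AE_eventually_growth:
  assumes K: "1 \<le> K" and \<epsilon>: "0 < \<epsilon>"
    and summable: "summable (\<lambda>n. \<Prod>k<n. (1 + pmf (q k) 1) / 2)"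
  shows "AE x in M. \<forall>\<^sub>F n in sequentially.
    (1 - \<epsilon>) * real (Z n x) * truncated_mean K (q n) \<le> real (Z (Suc n) x)"
proof -
  let ?m = "\<lambda>n. truncated_mean K (q n)"
  let ?C = "(real K)\<^sup>2 / \<epsilon>\<^sup>2"
  let ?r = "\<lambda>n. \<Prod>k<n. (1 + pmf (q k) 1) / 2"
  define bad where "bad n x \<longleftrightarrow> real (Z (Suc n) x) < (1 - \<epsilon>) * real (Z n x) * ?m n" for n x
  have "AE x in M. (\<lambda>n. of_bool (bad n x) :: real) \<longlonglongrightarrow> 0"
  proof (rule AE_tendsto_zero_of_summable_integrals)
    show "(\<lambda>x. of_bool (bad n x) :: real) \<in> borel_measurable M" for n
      unfolding bad_def by measurable
    show "0 \<le> (of_bool (bad n x) :: real)" for n x by simp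
    show "0 \<le> ?C * ?r n" for n by (intro mult_nonneg_nonneg prod_nonneg) auto
    show "summable (\<lambda>n. ?C * ?r n)" by (intro summable_mult summable)
    fix n
    let ?f = "\<lambda>z (w :: nat \<Rightarrow> nat). of_bool (real (\<Sum>i = 1..z. min (w i) K) < (1 - \<epsilon>) * real z * ?m n) :: ennreal"
    have fm: "?f z \<in> borel_measurable (\<Pi>\<^sub>M i\<in>{1..}. count_space UNIV)" for z
    proof -
      have [measurable]: "(\<lambda>w. real (\<Sum>i = 1..z. min (w i) K))
          \<in> borel_measurable (\<Pi>\<^sub>M i\<in>{1..}. count_space (UNIV :: nat set))"
        unfolding of_nat_sum
      proof (rule borel_measurable_sum)
        fix i assume "i \<in> {1..z}"
        then have "(\<lambda>w. w i) \<in> (\<Pi>\<^sub>M i\<in>{1..}. count_space (UNIV :: nat set)) \<rightarrow>\<^sub>M count_space UNIV"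
          by (intro measurable_component_singleton) auto
        then show "(\<lambda>w. real (min (w i) K)) \<in> borel_measurable (\<Pi>\<^sub>M i\<in>{1..}. count_space (UNIV :: nat set))"
          by (rule measurable_compose) simp
      qed
      show ?thesis by measurable
    qed
    \<comment> \<open>Truncation only lowers the sum of the offspring, so a bad step forces the
      truncated sum below the same threshold.\<close>
    have "(\<integral>\<^sup>+ x. ennreal (of_bool (bad n x)) \<partial>M)
        \<le> (\<integral>\<^sup>+ x. ?f (Z n x) (\<lambda>i\<in>{1..}. X n i x) \<partial>M)"
    proof (intro nn_integral_mono)
      fix x
      have "(\<Sum>i = 1..Z n x. min ((\<lambda>i\<in>{1..}. X n i x) i) K) \<le> Z (Suc n) x"
        by (auto intro!: sum_mono)
      then have "real (\<Sum>i = 1..Z n x. min ((\<lambda>i\<in>{1..}. X n i x) i) K) \<le> real (Z (Suc n) x)"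
        by (simp only: of_nat_le_iff)
      then show "ennreal (of_bool (bad n x)) \<le> ?f (Z n x) (\<lambda>i\<in>{1..}. X n i x)"
        unfolding bad_def by (auto simp: of_bool_def simp del: gen_size.simps of_nat_sum)
    qed
    also have "\<dots> = (\<integral>\<^sup>+ x. (\<integral>\<^sup>+ y. ?f (Z n x) (\<lambda>i\<in>{1..}. X n i y) \<partial>M) \<partial>M)"
      by (rule nn_integral_generation[OF fm])
    also have "\<dots> \<le> (\<integral>\<^sup>+ x. ennreal ?C * ennreal (1 / real (Z n x)) \<partial>M)"
      using AE_Z_pos
    proof (intro nn_integral_mono_AE, eventually_elim)
      case (elim x)
      have "(\<integral>\<^sup>+ y. ?f (Z n x) (\<lambda>i\<in>{1..}. X n i y) \<partial>M)
          = (\<integral>\<^sup>+ y. ?f (Z n x) (\<lambda>i. X n i y) \<partial>M)"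
        by simp
      also have "\<dots> \<le> ennreal (?C * (1 / real (Z n x)))"
        using elim by (intro prob_truncated_generation_small K \<epsilon>) auto
      also have "\<dots> = ennreal ?C * ennreal (1 / real (Z n x))"
        by (rule ennreal_mult) auto
      finally show ?case .
    qed
    also have "\<dots> = ennreal ?C * (\<integral>\<^sup>+ x. ennreal (1 / real (Z n x)) \<partial>M)"
      by (rule nn_integral_cmult) simp
    also have "\<dots> \<le> ennreal ?C * ennreal (?r n)"
      by (intro mult_left_mono nn_integral_inverse_Z) simp
    also have "\<dots> = ennreal (?C * ?r n)"
      by (intro ennreal_mult[symmetric] prod_nonneg) auto
    finally show "(\<integral>\<^sup>+ x. ennreal (of_bool (bad n x)) \<partial>M) \<le> ennreal (?C * ?r n)" .
  qed
  then show ?thesis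
  proof eventually_elim
    case (elim x)
    \<comment> \<open>An indicator below 1 is 0, so the bad event fails from some index on.\<close>
    have "\<forall>\<^sub>F n in sequentially. (of_bool (bad n x) :: real) < 1"
      using elim by (rule order_tendstoD) simp
    then show ?case
      by eventually_elim (auto simp: bad_def not_less simp del: gen_size.simps)
  qed
qed

text \<open>\<open>Z n\<close> divided by the product of the means has expectation 1. Weighted by
  \<open>exp (- \<epsilon>) ^ n\<close> these expectations are summable, so the weighted ratio tends
  to 0 and is eventually below 1; taking logarithms gives the bound.\<close>

lemma AE_eventually_le:
  assumes \<epsilon>: "0 < \<epsilon>"
  shows "AE x in M. \<forall>\<^sub>F n in sequentially. ln (real (Z n x)) \<le> (\<Sum>k<n. ln (mean k)) + \<epsilon> * real n"
proof -
  let ?P = "\<lambda>n. \<Prod>k<n. mean k"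
  have m: "0 < mean k" for k using mean_ge_1[of k] by simp
  have P: "0 < ?P n" for n using m by (intro prod_pos) auto
  have "AE x in M. (\<lambda>n. (exp (- \<epsilon>) ^ n / ?P n) * real (Z n x)) \<longlonglongrightarrow> 0"
  proof (rule AE_tendsto_zero_of_summable_integrals)
    show "summable (\<lambda>n. exp (- \<epsilon>) ^ n)"
      using \<epsilon> by (intro summable_geometric) simp
    fix n
    show "0 \<le> exp (- \<epsilon>) ^ n / ?P n * real (Z n x)" for x
      using P[of n] by simp
    have "(\<integral>\<^sup>+ x. ennreal (exp (- \<epsilon>) ^ n / ?P n * real (Z n x)) \<partial>M)
        = ennreal (exp (- \<epsilon>) ^ n / ?P n) * (\<integral>\<^sup>+ x. ennreal (real (Z n x)) \<partial>M)"
      using P[of n] 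
      by (subst nn_integral_cmult[symmetric])
         (auto simp: ennreal_mult[symmetric] simp del: times_divide_eq_left)
    also have "\<dots> = ennreal (exp (- \<epsilon>) ^ n / ?P n * ?P n)"
      unfolding nn_integral_Z using P[of n] by (intro ennreal_mult[symmetric]) auto
    also have "exp (- \<epsilon>) ^ n / ?P n * ?P n = exp (- \<epsilon>) ^ n"
      using less_imp_neq[OF P[of n]] by (metis nonzero_eq_divide_eq)
    finally show "(\<integral>\<^sup>+ x. ennreal (exp (- \<epsilon>) ^ n / ?P n * real (Z n x)) \<partial>M)
        \<le> ennreal (exp (- \<epsilon>) ^ n)" by simp
  qed simp_all
  with AE_Z_pos show ?thesis
  proof eventually_elim
    case (elim x)
    have "\<forall>\<^sub>F n in sequentially. (exp (- \<epsilon>) ^ n / ?P n) * real (Z n x) < 1"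
      using elim(2) by (rule order_tendstoD) simp
    then show ?case
    proof eventually_elim
      case (elim n)
      have Zn: "0 < real (Z n x)"
        using \<open>\<forall>n. 1 \<le> Z n x\<close> by (simp add: Suc_le_eq)
      have "real (Z n x) \<le> ?P n * exp (\<epsilon> * real n)"
        using elim P[of n] by (simp add: exp_minus exp_of_nat2_mult field_simps)
      then have "ln (real (Z n x)) \<le> ln (?P n * exp (\<epsilon> * real n))"
        using Zn by (intro ln_mono) auto
      also have "\<dots> = (\<Sum>k<n. ln (mean k)) + \<epsilon> * real n"
        using P[of n] m m[THEN less_imp_neq, symmetric] by (simp add: ln_mult ln_prod)
      finally show ?case .
    qed
  qed
qed

text \<open>The hypotheses are deterministic statements about one environment sequence, of the kind
  that the strong law provides for almost every environment. The upper bound comes from the full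
  means, the lower bound from the truncated means.\<close>

theorem AE_log_size_average:
  assumes mean_lim: "(\<lambda>n. (\<Sum>k<n. ln (mean k)) / real n) \<longlonglongrightarrow> \<mu>"
    and trunc_lim: "\<And>K. (\<lambda>n. (\<Sum>k<n. ln (truncated_mean (Suc K) (q k))) / real n) \<longlonglongrightarrow> \<nu> K"
    and \<nu>: "\<nu> \<longlonglongrightarrow> \<mu>"
    and single_lim: "(\<lambda>n. (\<Sum>k<n. 1 - pmf (q k) 1) / real n) \<longlonglongrightarrow> c" and c: "0 < c"
  shows "AE x in M. (\<lambda>n. ln (real (Z n x)) / real n) \<longlonglongrightarrow> \<mu>"
proof -
  have summable: "summable (\<lambda>n. \<Prod>k<n. (1 + pmf (q k) 1) / 2)"
    by (rule summable_prod_of_average[OF _ _ single_lim c]) (auto simp: pmf_le_1)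
  \<comment> \<open>One index \<open>j\<close> governs both the tolerance \<open>e j\<close> and the
    truncation level \<open>Suc j\<close>, so only countably many null sets are discarded. The shift
    by 2 keeps \<open>1 - e j\<close> positive, so that its logarithm is meaningful.\<close>
  define e :: "nat \<Rightarrow> real" where "e j = 1 / real (j + 2)" for j
  have e: "0 < e j" "e j < 1" for j by (auto simp: e_def)
  have e_lim: "e \<longlonglongrightarrow> 0" 
    unfolding e_def by (rule LIMSEQ_ignore_initial_segment[OF lim_1_over_n])
  have "AE x in M. \<forall>j. \<forall>\<^sub>F n in sequentially. ln (real (Z n x)) \<le> (\<Sum>k<n. ln (mean k)) + e j * real n"
    using AE_eventually_le[OF e(1)] by (simp add: AE_all_countable)
  moreover have "AE x in M. \<forall>j. \<forall>\<^sub>F n in sequentially.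
      (1 - e j) * real (Z n x) * truncated_mean (Suc j) (q n) \<le> real (Z (Suc n) x)"
    using AE_eventually_growth[OF _ e(1) summable] by (simp add: AE_all_countable del: gen_size.simps)
  ultimately show ?thesis using AE_Z_pos
  proof eventually_elim
    case (elim x)
    have Zn: "0 < real (Z n x)" for n
      using elim(3) by (simp add: Suc_le_eq)
    show ?case
    proof (rule order_tendstoI)
      fix y assume y: "\<mu> < y"
      have "(\<lambda>j. \<mu> + e j) \<longlonglongrightarrow> \<mu> + 0" by (intro tendsto_intros e_lim)
      then have "\<forall>\<^sub>F j in sequentially. \<mu> + e j < y"
        using y by (intro order_tendstoD) auto
      then obtain j where j: "\<mu> + e j < y" by (auto simp: eventually_sequentially)
      have "(\<lambda>n. (\<Sum>k<n. ln (mean k)) / real n + e j) \<longlonglongrightarrow> \<mu> + e j"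
        by (intro tendsto_intros mean_lim)
      then have "\<forall>\<^sub>F n in sequentially. (\<Sum>k<n. ln (mean k)) / real n + e j < y"
        using j by (intro order_tendstoD) auto
      with elim(1)[rule_format, of j] eventually_gt_at_top[of 0]
      show "\<forall>\<^sub>F n in sequentially. ln (real (Z n x)) / real n < y"
      proof eventually_elim
        case (elim n)
        have "ln (real (Z n x)) / real n \<le> ((\<Sum>k<n. ln (mean k)) + e j * real n) / real n"
          using elim by (intro divide_right_mono) auto
        also have "\<dots> = (\<Sum>k<n. ln (mean k)) / real n + e j"
          using elim by (simp add: add_divide_distrib)
        finally show ?case using elim by simp
      qed
    next
      fix y assume y: "y < \<mu>"
      have "(\<lambda>j. ln (1 - e j) + \<nu> j) \<longlonglongrightarrow> ln (1 - 0) + \<mu>"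
        by (intro tendsto_intros e_lim \<nu>) simp
      then have "\<forall>\<^sub>F j in sequentially. y < ln (1 - e j) + \<nu> j"
        using y by (intro order_tendstoD) auto
      then obtain j where j: "y < ln (1 - e j) + \<nu> j" by (auto simp: eventually_sequentially)
      let ?m = "\<lambda>n. truncated_mean (Suc j) (q n)"
      have m: "0 < ?m n" for n
        using truncated_mean_ge_1[of "Suc j" "q n"] no_death by (simp add: less_le_trans[OF zero_less_one])
      show "\<forall>\<^sub>F n in sequentially. y < ln (real (Z n x)) / real n"
      proof (rule eventually_average_ge[OF _ _ j])
        show "\<forall>\<^sub>F n in sequentially. ln (real (Z n x)) + (ln (1 - e j) + ln (?m n)) \<le> ln (real (Z (Suc n) x))"
          using elim(2)[rule_format, of j]
        proof eventually_elim
          case (elim n)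
          have "ln ((1 - e j) * real (Z n x) * ?m n) \<le> ln (real (Z (Suc n) x))"
            using elim e[of j] Zn[of n] m[of n] by (intro ln_mono) auto
          then show ?case
            using e[of j] Zn[of n] m[of n] by (simp add: ln_mult del: gen_size.simps)
        qed
        have "(\<lambda>n. ln (1 - e j) + (\<Sum>k<n. ln (?m k)) / real n) \<longlonglongrightarrow> ln (1 - e j) + \<nu> j"
          by (intro tendsto_intros trunc_lim)
        then show "(\<lambda>n. (\<Sum>k<n. ln (1 - e j) + ln (?m k)) / real n) \<longlonglongrightarrow> ln (1 - e j) + \<nu> j"
        proof (rule Lim_transform_eventually)
          show "\<forall>\<^sub>F n in sequentially. ln (1 - e j) + (\<Sum>k<n. ln (?m k)) / real n
              = (\<Sum>k<n. ln (1 - e j) + ln (?m k)) / real n"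
            using eventually_gt_at_top[of 0]
            by eventually_elim (simp add: sum.distrib field_simps)
        qed
      qed
    qed
  qed
qed

end

section \<open>From the quenched to the annealed law\<close>

text \<open>Convergence of a nonnegative series means that its extended sum, which is measurable, is
  finite. The finiteness of \<open>m_0\<close> can then be transferred between laws as an almost
  sure statement.\<close>

lemma pred_summable_nonneg:
  fixes f :: "nat \<Rightarrow> 'a \<Rightarrow> real"
  assumes [measurable]: "\<And>k. f k \<in> borel_measurable M" and nonneg: "\<And>k x. 0 \<le> f k x"
  shows "Measurable.pred M (\<lambda>x. summable (\<lambda>k. f k x))"
proof -
  have "summable (\<lambda>k. f k x) \<longleftrightarrow> (\<Sum>k. ennreal (f k x)) \<noteq> \<top>" for x
    using summable_suminf_not_top[of "\<lambda>k. f k x"] ennreal_suminf_neq_top[of "\<lambda>k. f k x"]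
    by (rule iffI[rotated]) (use nonneg in blast)+
  then show ?thesis by (simp only:) measurable
qed

text \<open>Restricting the tolerances to \<open>1 / (m + 1)\<close> leaves only countable
  quantifiers. The measurability is what \<open>AE_annealed_iff\<close> asks of the final
  convergence statement.\<close>

lemma pred_tendsto_const:
  fixes f :: "nat \<Rightarrow> 'a \<Rightarrow> real"
  assumes [measurable]: "\<And>n. f n \<in> borel_measurable M"
  shows "Measurable.pred M (\<lambda>x. (\<lambda>n. f n x) \<longlonglongrightarrow> c)"
proof -
  have "(\<lambda>n. f n x) \<longlonglongrightarrow> c \<longleftrightarrow> (\<forall>m. \<exists>k. \<forall>n. k \<le> n \<longrightarrow> \<bar>f n x - c\<bar> < inverse (real (Suc m)))" for x
  proof
    assume lim: "(\<lambda>n. f n x) \<longlonglongrightarrow> c"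
    show "\<forall>m. \<exists>k. \<forall>n. k \<le> n \<longrightarrow> \<bar>f n x - c\<bar> < inverse (real (Suc m))"
      using LIMSEQ_D[OF lim, of "inverse (real (Suc _))"] by simp
  next
    assume *: "\<forall>m. \<exists>k. \<forall>n. k \<le> n \<longrightarrow> \<bar>f n x - c\<bar> < inverse (real (Suc m))"
    show "(\<lambda>n. f n x) \<longlonglongrightarrow> c"
    proof (rule LIMSEQ_I)
      fix r :: real assume "0 < r"
      then obtain m where m: "inverse (real (Suc m)) < r" using reals_Archimedean by blast
      then show "\<exists>no. \<forall>n\<ge>no. norm (f n x - c) < r"
        using * by (metis less_trans real_norm_def)
    qed
  qed
  then show ?thesis by simp
qed

section \<open>The i.i.d. environment and its strong law\<close>

lemma env_law_component:
  assumes "prob_space N"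
  shows "distr (env_law N) N (\<lambda>\<xi>. \<xi> n) = N"
  unfolding env_law_def using assms distr_PiM_component[of UNIV "\<lambda>_. N" n] by simp

lemma env_law_component_measurable: "(\<lambda>\<xi>. \<xi> n) \<in> env_law N \<rightarrow>\<^sub>M N"
  unfolding env_law_def by simp

lemma AE_env_law_all:
  assumes N: "prob_space N" and P: "AE e in N. P e"
  shows "AE \<xi> in env_law N. \<forall>n. P (\<xi> n)"
  unfolding AE_all_countable env_law_def
  by (intro allI AE_PiM_component[where P=P] N P) auto

text \<open>Under the product law the coordinates are independent with common law \<open>N\<close>,
  so \<open>strong_law_nonneg_L2\<close> applies to their images under \<open>g\<close>.\<close>

lemma env_law_strong_law:
  fixes g :: "'e \<Rightarrow> real"
  assumes N: "prob_space N" and g [measurable]: "g \<in> borel_measurable N"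
    and nonneg: "AE e in N. 0 \<le> g e" and sq: "integrable N (\<lambda>e. (g e)\<^sup>2)"
  shows "AE \<xi> in env_law N. (\<lambda>n. (\<Sum>k<n. g (\<xi> k)) / real n) \<longlonglongrightarrow> (\<integral>e. g e \<partial>N)"
proof -
  interpret T: prob_space "env_law N"
    unfolding env_law_def by (intro prob_space_PiM N)
  have push: "integral\<^sup>L N h = (\<integral>\<xi>. h (\<xi> k) \<partial>env_law N)"
    if "h \<in> borel_measurable N" for h :: "'e \<Rightarrow> real" and k
    using integral_distr[OF env_law_component_measurable that, of k]
    unfolding env_law_component[OF N] .
  have comp: "T.indep_vars (\<lambda>_. N) (\<lambda>n \<xi>. \<xi> n) UNIV"
  proof (subst T.indep_vars_iff_distr_eq_PiM')
    have "distr (env_law N) (\<Pi>\<^sub>M i\<in>UNIV. N) (\<lambda>x. \<lambda>i\<in>UNIV. x i) = env_law N"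
      by (simp add: env_law_def restrict_def distr_id)
    also have "\<dots> = (\<Pi>\<^sub>M i\<in>UNIV. distr (env_law N) N (\<lambda>\<xi>. \<xi> i))"
      by (simp add: env_law_component[OF N]) (simp add: env_law_def)
    finally show "distr (env_law N) (\<Pi>\<^sub>M i\<in>UNIV. N) (\<lambda>x. \<lambda>i\<in>UNIV. x i)
      = (\<Pi>\<^sub>M i\<in>UNIV. distr (env_law N) N (\<lambda>\<xi>. \<xi> i))" .
  qed (auto intro: env_law_component_measurable)
  show ?thesis
  proof (rule T.strong_law_nonneg_L2)
    show "T.indep_vars (\<lambda>_. borel) (\<lambda>k \<xi>. g (\<xi> k)) UNIV"
      by (rule T.indep_vars_compose2[OF comp]) (rule g)
    show "AE \<xi> in env_law N. 0 \<le> g (\<xi> k)" for k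
      using AE_env_law_all[OF N nonneg] by eventually_elim simp
    show "integrable (env_law N) (\<lambda>\<xi>. (g (\<xi> k))\<^sup>2)" for k
      using integrable_distr_eq[OF env_law_component_measurable, of "\<lambda>e. (g e)\<^sup>2" N k] sq
      by (simp add: env_law_component[OF N])
    show "T.expectation (\<lambda>\<xi>. g (\<xi> k)) = (\<integral>e. g e \<partial>N)" for k
      by (rule push[OF g, symmetric])
    then show "T.variance (\<lambda>\<xi>. g (\<xi> k)) = (\<integral>e. (g e - (\<integral>e. g e \<partial>N))\<^sup>2 \<partial>N)" for k
      using push[of "\<lambda>e. (g e - (\<integral>e. g e \<partial>N))\<^sup>2" k] by simp
  qed
qed

text \<open>The annealed law is a mixture of quenched laws, so a measurable event is almost sure for
  it exactly when it is quenched almost sure in almost every environment. This reduces the claim to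
  one environment at a time.\<close>

lemma
  assumes bpre: "bpre N p \<Gamma> Q X"
  shows sets_annealed: "sets (annealed N \<Gamma> Q) = sets (\<Gamma> \<Otimes>\<^sub>M env_law N)"
    and AE_annealed_iff: "\<And>P. Measurable.pred (\<Gamma> \<Otimes>\<^sub>M env_law N) P \<Longrightarrow>
      (AE z in annealed N \<Gamma> Q. P z) \<longleftrightarrow> (AE \<xi> in env_law N. AE x in Q \<xi>. P (x, \<xi>))"
proof -
  have N: "prob_space N" and Q: "Q \<in> env_law N \<rightarrow>\<^sub>M subprob_algebra \<Gamma>"
    using bpre by (auto simp: bpre_def intro: measurable_prob_algebraD)
  interpret T: prob_space "env_law N"
    unfolding env_law_def by (intro prob_space_PiM N)
  have D: "(\<lambda>\<xi>. distr (Q \<xi>) (\<Gamma> \<Otimes>\<^sub>M env_law N) (\<lambda>x. (x, \<xi>)))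
      \<in> env_law N \<rightarrow>\<^sub>M subprob_algebra (\<Gamma> \<Otimes>\<^sub>M env_law N)"
    by (rule measurable_distr2[OF _ Q]) simp
  show "sets (annealed N \<Gamma> Q) = sets (\<Gamma> \<Otimes>\<^sub>M env_law N)"
    unfolding annealed_def by (rule sets_bind_measurable[OF D T.not_empty])
  fix P assume P: "Measurable.pred (\<Gamma> \<Otimes>\<^sub>M env_law N) P"
  have "(AE z in annealed N \<Gamma> Q. P z) \<longleftrightarrow>
      (AE \<xi> in env_law N. AE z in distr (Q \<xi>) (\<Gamma> \<Otimes>\<^sub>M env_law N) (\<lambda>x. (x, \<xi>)). P z)"
    unfolding annealed_def by (rule AE_bind[OF D P])
  also have "\<dots> \<longleftrightarrow> (AE \<xi> in env_law N. AE x in Q \<xi>. P (x, \<xi>))"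
  proof (rule AE_cong)
    fix \<xi> assume \<xi>: "\<xi> \<in> space (env_law N)"
    have s: "sets (Q \<xi>) = sets \<Gamma>" using Q \<xi> by (rule sets_kernel)
    have "(\<lambda>x. (x, \<xi>)) \<in> Q \<xi> \<rightarrow>\<^sub>M \<Gamma> \<Otimes>\<^sub>M env_law N"
      using \<xi> by (simp add: measurable_cong_sets[OF s refl])
    then show "(AE z in distr (Q \<xi>) (\<Gamma> \<Otimes>\<^sub>M env_law N) (\<lambda>x. (x, \<xi>)). P z) \<longleftrightarrow> (AE x in Q \<xi>. P (x, \<xi>))"
      using P by (intro AE_distr_iff) (auto simp: pred_def)
  qed
  finally show "(AE z in annealed N \<Gamma> Q. P z) \<longleftrightarrow> (AE \<xi> in env_law N. AE x in Q \<xi>. P (x, \<xi>))" .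
qed

text \<open>Each quenched law has total mass 1, so forgetting the process leaves the environment
  law, whose first coordinate has law \<open>N\<close>. The standing assumptions, stated under the
  annealed law, can thus be read as statements about \<open>N\<close>.\<close>

lemma distr_annealed_env:
  assumes bpre: "bpre N p \<Gamma> Q X"
  shows "distr (annealed N \<Gamma> Q) N (\<lambda>z. snd z 0) = N"
proof -
  have N: "prob_space N" and Q: "Q \<in> env_law N \<rightarrow>\<^sub>M prob_algebra \<Gamma>"
    using bpre by (auto simp: bpre_def)
  have snd_m: "snd \<in> annealed N \<Gamma> Q \<rightarrow>\<^sub>M env_law N"
    by (simp add: measurable_cong_sets[OF sets_annealed[OF bpre] refl])
  have "distr (annealed N \<Gamma> Q) (env_law N) snd = env_law N"
  proof (rule measure_eqI)
    fix A assume "A \<in> sets (distr (annealed N \<Gamma> Q) (env_law N) snd)"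
    then have A: "A \<in> sets (env_law N)" by simp
    have A': "snd -` A \<inter> space (annealed N \<Gamma> Q) \<in> sets (\<Gamma> \<Otimes>\<^sub>M env_law N)"
      using measurable_sets[OF snd_m A] by (simp add: sets_annealed[OF bpre])
    have "emeasure (distr (annealed N \<Gamma> Q) (env_law N) snd) A
        = (\<integral>\<^sup>+ \<xi>. emeasure (Q \<xi>) {x \<in> space \<Gamma>. (x, \<xi>) \<in> snd -` A \<inter> space (annealed N \<Gamma> Q)} \<partial>env_law N)"
      using A by (simp only: emeasure_distr[OF snd_m] emeasure_annealed[OF bpre A'])
    also have "\<dots> = (\<integral>\<^sup>+ \<xi>. indicator A \<xi> \<partial>env_law N)"
    proof (rule nn_integral_cong)
      fix \<xi> assume \<xi>: "\<xi> \<in> space (env_law N)"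
      have "Q \<xi> \<in> space (prob_algebra \<Gamma>)" using Q \<xi> by (rule measurable_space)
      then have s: "sets (Q \<xi>) = sets \<Gamma>" and "prob_space (Q \<xi>)"
        by (auto simp: space_prob_algebra)
      then have "emeasure (Q \<xi>) (space \<Gamma>) = 1"
        using prob_space.emeasure_space_1[of "Q \<xi>"] by (simp add: sets_eq_imp_space_eq[OF s])
      moreover have "{x \<in> space \<Gamma>. (x, \<xi>) \<in> snd -` A \<inter> space (annealed N \<Gamma> Q)}
          = (if \<xi> \<in> A then space \<Gamma> else {})"
        using \<xi> by (auto simp: sets_eq_imp_space_eq[OF sets_annealed[OF bpre]] space_pair_measure)
      ultimately show "emeasure (Q \<xi>) {x \<in> space \<Gamma>. (x, \<xi>) \<in> snd -` A \<inter> space (annealed N \<Gamma> Q)}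
          = indicator A \<xi>" by simp
    qed
    finally show "emeasure (distr (annealed N \<Gamma> Q) (env_law N) snd) A = emeasure (env_law N) A"
      using A by simp
  qed simp
  then have "distr (distr (annealed N \<Gamma> Q) (env_law N) snd) N (\<lambda>\<xi>. \<xi> 0) = N"
    by (simp add: env_law_component[OF N])
  then show ?thesis
    by (subst (asm) distr_distr[OF _ snd_m]) (auto simp: comp_def intro: env_law_component_measurable)
qed

section \<open>Verification of the quenched hypotheses for almost every environment\<close>

theorem corollary2p1:
  fixes N :: "'e measure"
    and p :: "'e \<Rightarrow> nat pmf"
    and \<Gamma> :: "'x measure"
    and Q :: "(nat \<Rightarrow> 'e) \<Rightarrow> 'x measure"
    and X :: "nat \<Rightarrow> nat \<Rightarrow> 'x \<Rightarrow> nat"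
    and \<delta> :: real
  assumes "bpre N p \<Gamma> Q X"
    and "standing_assumptions N p \<Gamma> Q X"
    and "0 < \<delta>" and "\<delta> < 1"
    and "integrable (annealed N \<Gamma> Q) (\<lambda>(x, \<xi>). log_mean p \<xi> powr (2 + \<delta>))"
  shows "AE (x, \<xi>) in annealed N \<Gamma> Q.
    (\<lambda>n. ln (real (gen_size X n x)) / real n) \<longlonglongrightarrow> criticality N p \<Gamma> Q"
proof -
  note bpre = assms(1)
  note standing = assms(2)[unfolded standing_assumptions_def]
  have N: "prob_space N" and Q: "Q \<in> env_law N \<rightarrow>\<^sub>M prob_algebra \<Gamma>"
    and p [measurable]: "\<And>k. (\<lambda>e. pmf (p e) k) \<in> borel_measurable N"
    and X: "\<And>n i. 1 \<le> i \<Longrightarrow> X n i \<in> \<Gamma> \<rightarrow>\<^sub>M count_space UNIV"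
    using bpre by (auto simp: bpre_def)
  interpret N: prob_space N by (rule N)
  let ?A = "annealed N \<Gamma> Q"
  let ?\<mu> = "criticality N p \<Gamma> Q"
  note env_distr = distr_annealed_env[OF bpre]
  have env [measurable]: "(\<lambda>z. snd z 0) \<in> ?A \<rightarrow>\<^sub>M N"
    by (subst measurable_cong_sets[OF sets_annealed[OF bpre] refl])
       (rule measurable_compose[OF measurable_snd env_law_component_measurable])
  have AE_env: "AE e in N. P e" if "Measurable.pred N P" "AE (x, \<xi>) in ?A. P (\<xi> 0)" for P
  proof -
    have "AE e in distr ?A N (\<lambda>z. snd z 0). P e"
      using that by (subst AE_distr_iff) (auto simp: case_prod_beta' pred_def)
    then show ?thesis unfolding env_distr .
  qed
  have int_env: "integrable N h" if "h \<in> borel_measurable N" "integrable ?A (\<lambda>(x, \<xi>). h (\<xi> 0))"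
    for h :: "'e \<Rightarrow> real"
  proof -
    have "integrable (distr ?A N (\<lambda>z. snd z 0)) h"
      using that by (subst integrable_distr_eq) (auto simp: case_prod_beta')
    then show ?thesis unfolding env_distr .
  qed

  \<comment> \<open>As a function of a single environment state, so that \<open>ln m_k\<close> is
    \<open>G (\<xi> k)\<close> for every generation \<open>k\<close>.\<close>
  define G where "G e = ln (\<Sum>i. real i * pmf (p e) i)" for e
  have G [measurable]: "G \<in> borel_measurable N"
    unfolding G_def by measurable
  have log_mean: "log_mean p = (\<lambda>\<xi>. G (\<xi> 0))"
    by (simp add: fun_eq_iff log_mean_def offspring_mean_def G_def)
  have \<mu>: "?\<mu> = (\<integral>e. G e \<partial>N)"
  proof -
    have "(\<integral>e. G e \<partial>distr ?A N (\<lambda>z. snd z 0)) = (\<integral>z. G (snd z 0) \<partial>?A)"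
      by (rule integral_distr) simp_all
    then show ?thesis
      by (simp add: criticality_def log_mean case_prod_beta' env_distr)
  qed
  have G_int: "integrable N G"
    using standing by (intro int_env) (auto simp: log_mean)
  have "integrable N (\<lambda>e. (G e - ?\<mu>)\<^sup>2)"
    using standing by (intro int_env) (auto simp: log_mean)
  \<comment> \<open>This is the square of \<open>G e\<close> after expansion: finite variance and
    finite mean give the second moment used by the strong law.\<close>
  then have "integrable N (\<lambda>e. (G e - ?\<mu>)\<^sup>2 + 2 * ?\<mu> * G e - ?\<mu>\<^sup>2)"
    using G_int by simp
  then have G_sq: "integrable N (\<lambda>e. (G e)\<^sup>2)"
    by (simp add: power2_diff algebra_simps)

  have "AE e in N. summable (\<lambda>i. real i * pmf (p e) i)"
    using standing by (intro AE_env pred_summable_nonneg) auto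
  moreover have "AE e in N. pmf (p e) 0 = 0"
    using standing by (intro AE_env) auto
  ultimately have good: "AE e in N. pmf (p e) 0 = 0 \<and> integrable (p e) real \<and>
      G e = ln (measure_pmf.expectation (p e) real) \<and> 1 \<le> measure_pmf.expectation (p e) real"
  proof eventually_elim
    case (elim e)
    then have int: "integrable (p e) real"
      by (simp add: integrable_pmf_nat_iff mult.commute)
    then show ?case
      using elim expectation_pmf_ge_1[OF int]
      by (simp add: G_def expectation_pmf_nat mult.commute)
  qed

  let ?t = "\<lambda>K e. ln (truncated_mean (Suc K) (p e))"
  have t [measurable]: "?t K \<in> borel_measurable N" for K
    using truncated_mean_measurable[of p N "Suc K"] by simp
  have t_bounds: "AE e in N. 0 \<le> ?t K e \<and> ?t K e \<le> G e \<and> ?t K e \<le> ln (real (Suc K))" for K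
    using good
  proof eventually_elim
    case (elim e)
    have "1 \<le> truncated_mean (Suc K) (p e)"
      using elim by (intro truncated_mean_ge_1) auto
    moreover have "truncated_mean (Suc K) (p e) \<le> measure_pmf.expectation (p e) real"
      using elim by (intro truncated_mean_le_mean) auto
    moreover have "truncated_mean (Suc K) (p e) \<le> real (Suc K)"
      by (rule truncated_mean_le)
    ultimately show ?case using elim by (auto intro!: ln_mono)
  qed
  have "AE \<xi> in env_law N. (\<lambda>n. (\<Sum>k<n. ?t K (\<xi> k)) / real n) \<longlonglongrightarrow> (\<integral>e. ?t K e \<partial>N)" for K
  proof (rule env_law_strong_law[OF N t])
    show "AE e in N. 0 \<le> ?t K e" using t_bounds[of K] by eventually_elim simp
    have "AE e in N. norm ((?t K e)\<^sup>2) \<le> (ln (real (Suc K)))\<^sup>2"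
      using t_bounds[of K] by eventually_elim (auto intro: power_mono)
    then show "integrable N (\<lambda>e. (?t K e)\<^sup>2)"
      by (rule N.integrable_const_bound) simp
  qed
  then have trunc_law: "AE \<xi> in env_law N. \<forall>K.
      (\<lambda>n. (\<Sum>k<n. ?t K (\<xi> k)) / real n) \<longlonglongrightarrow> (\<integral>e. ?t K e \<partial>N)"
    by (simp add: AE_all_countable)
  \<comment> \<open>Dominated convergence with \<open>G\<close> itself as the integrable bound,
    since the truncated logarithms lie between 0 and \<open>G\<close>.\<close>
  have trunc_lim: "(\<lambda>K. \<integral>e. ?t K e \<partial>N) \<longlonglongrightarrow> ?\<mu>"
    unfolding \<mu>
  proof (rule integral_dominated_convergence[OF G t G_int])
    show "AE e in N. (\<lambda>K. ?t K e) \<longlonglongrightarrow> G e"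
      using good
    proof eventually_elim
      case (elim e)
      have "(\<lambda>K. ?t K e) \<longlonglongrightarrow> ln (measure_pmf.expectation (p e) real)"
        using elim by (intro tendsto_ln LIMSEQ_Suc truncated_mean_tendsto) auto
      then show ?case using elim by simp
    qed
    show "AE e in N. norm (?t K e) \<le> G e" for K
      using t_bounds[of K] by eventually_elim simp
  qed
  have mean_law: "AE \<xi> in env_law N. (\<lambda>n. (\<Sum>k<n. G (\<xi> k)) / real n) \<longlonglongrightarrow> ?\<mu>"
    unfolding \<mu>
  proof (rule env_law_strong_law[OF N G _ G_sq])
    show "AE e in N. 0 \<le> G e" using good by eventually_elim simp
  qed
  \<comment> \<open>In the absence of death this is the annealed probability that an individual has
    at least two children.\<close>
  let ?c = "\<integral>e. 1 - pmf (p e) 1 \<partial>N"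
  have single_sq: "integrable N (\<lambda>e. (1 - pmf (p e) 1)\<^sup>2)"
    by (rule N.integrable_const_bound[where B=1]) (auto simp: pmf_le_1 intro!: power_le_one)
  have single_law: "AE \<xi> in env_law N. (\<lambda>n. (\<Sum>k<n. 1 - pmf (p (\<xi> k)) 1) / real n) \<longlonglongrightarrow> ?c"
    using single_sq by (intro env_law_strong_law[OF N]) (auto simp: pmf_le_1)
  \<comment> \<open>Otherwise almost every environment gives exactly one child, so
    \<open>m_0 = 1\<close> almost surely and the mean of its logarithm is 0, contrary to
    supercriticality.\<close>
  have c: "0 < ?c"
  proof (rule ccontr)
    have int: "integrable N (\<lambda>e. 1 - pmf (p e) 1)"
      by (rule N.integrable_const_bound[where B=1]) (auto simp: pmf_le_1)
    have "0 \<le> ?c" by (intro Bochner_Integration.integral_nonneg) (simp add: pmf_le_1)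
    moreover assume "\<not> 0 < ?c"
    ultimately have "?c = 0" by simp
    then have "AE e in N. 1 - pmf (p e) 1 = 0"
      using int by (subst (asm) integral_nonneg_eq_0_iff_AE) (auto simp: pmf_le_1)
    with good have "AE e in N. G e = 0"
      by eventually_elim (simp add: expectation_pmf_eq_1)
    then have "?\<mu> = 0" unfolding \<mu> by (intro integral_eq_zero_AE)
    with standing show False by simp
  qed

  have law: "AE \<xi> in env_law N. \<forall>n.
        (\<forall>i\<ge>1. \<forall>k. measure (Q \<xi>) {x \<in> space (Q \<xi>). X n i x = k} = pmf (p (\<xi> n)) k) \<and>
        prob_space.indep_vars (Q \<xi>) (\<lambda>_. count_space UNIV) (X n) {1..} \<and>
        prob_space.indep_var (Q \<xi>)
          (\<Pi>\<^sub>M i\<in>{1..}. count_space UNIV) (\<lambda>x. \<lambda>i\<in>{1..}. X n i x)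
          (\<Pi>\<^sub>M j\<in>{1..n}. count_space UNIV) (\<lambda>x. \<lambda>j\<in>{1..n}. gen_size X j x)"
    using bpre by (simp add: bpre_def)
  have "AE \<xi> in env_law N. AE x in Q \<xi>. (\<lambda>n. ln (real (gen_size X n x)) / real n) \<longlonglongrightarrow> ?\<mu>"
    using AE_space law AE_env_law_all[OF N good] mean_law trunc_law single_law
  proof eventually_elim
    case (elim \<xi>)
    have "Q \<xi> \<in> space (prob_algebra \<Gamma>)" using Q elim(1) by (rule measurable_space)
    then have s: "sets (Q \<xi>) = sets \<Gamma>" and "prob_space (Q \<xi>)"
      by (auto simp: space_prob_algebra)
    interpret prob_space "Q \<xi>" by fact
    interpret branching_process "Q \<xi>" "\<lambda>n. p (\<xi> n)" X
      using elim(2,3) X by unfold_locales (auto simp: measurable_cong_sets[OF s refl])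
    show ?case
    proof (rule AE_log_size_average[OF _ _ trunc_lim _ c])
      show "(\<lambda>n. (\<Sum>k<n. ln (mean k)) / real n) \<longlonglongrightarrow> ?\<mu>"
        using elim(3,4) by simp
      show "(\<lambda>n. (\<Sum>k<n. ln (truncated_mean (Suc K) (p (\<xi> k)))) / real n) \<longlonglongrightarrow> (\<integral>e. ?t K e \<partial>N)" for K
        using elim(5) by blast
      show "(\<lambda>n. (\<Sum>k<n. 1 - pmf (p (\<xi> k)) 1) / real n) \<longlonglongrightarrow> ?c"
        by (rule elim(6))
    qed
  qed
  then show ?thesis
    using gen_size_measurable[of X \<Gamma>, OF X]
    by (subst AE_annealed_iff[OF bpre]) (auto simp: case_prod_beta' intro!: pred_tendsto_const)
qed

end
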